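(* The number of incidences between any set $P$ of $m$ directed points and any set $C$ of $n$ circles (of arbitrary radii) in the plane is $$O\left(m^{3/5}n^{3/5}+m+n\right),$$ where the implied constant is absolute.
   Context: A directed point in the plane is a pair $(p,u)$, where $p\in\mathbb{R}^2$ and $u$ is a direction, represented by its slope (so opposite vectors give the same direction). A circle $c$ in the plane is incident (or tangent) to the directed point $(p,u)$ if $p\in c$ and the tangent line to $c$ at $p$ has direction $u$. The number of incidences between $P$ and $C$ is the number of pairs $((p,u),c)$ with $(p,u)\in P$, $c\in C$, and $c$ incident to $(p,u)$. *)

theory Defs
  imports "HOL-Analysis.Analysis"
begin

(* Slopes of lines in the plane, with Vertical as the infinite slope, so that every
   direction of the plane, up to sign, is represented exactly once. *)
datatype slope = Slope real | Vertical

(* Meaningful for v \<noteq> 0 only. *)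
definition slope_of :: "real^2 \<Rightarrow> slope" where
  "slope_of v = (if v $ 1 = 0 then Vertical else Slope (v $ 2 / v $ 1))"

type_synonym directed_point = "(real^2) \<times> slope"

definition is_circle :: "(real^2) set \<Rightarrow> bool" where
  "is_circle c \<longleftrightarrow> (\<exists>a r. 0 < r \<and> c = sphere a r)"

definition has_direction :: "(real^2) set \<Rightarrow> slope \<Rightarrow> bool" where
  "has_direction L u \<longleftrightarrow> (\<exists>q v. v \<noteq> 0 \<and> L = {q + t *\<^sub>R v |t. True} \<and> slope_of v = u)"

(* The tangent line at p is the line through p perpendicular to the radius p - a;
   center and radius are determined by the circle c. *)
definition is_tangent_line :: "(real^2) set \<Rightarrow> real^2 \<Rightarrow> (real^2) set \<Rightarrow> bool" where
  "is_tangent_line c p L \<longleftrightarrow>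
     (\<exists>a r. 0 < r \<and> c = sphere a r \<and> p \<in> c \<and> L = {x. (x - p) \<bullet> (p - a) = 0})"

definition incident :: "directed_point \<Rightarrow> (real^2) set \<Rightarrow> bool" where
  "incident d c \<longleftrightarrow>
     fst d \<in> c \<and> (\<exists>L. is_tangent_line c (fst d) L \<and> has_direction L (snd d))"

definition incidences :: "directed_point set \<Rightarrow> (real^2) set set \<Rightarrow> nat" where
  "incidences P C = card {(d, c). d \<in> P \<and> c \<in> C \<and> incident d c}"

end

theory Submission
  imports Defs "HOL-Homology.Homology" "HOL-Computational_Algebra.Polynomial"
begin

text \<open>Lie's oriented circles: a circle with centre \<open>(a, b)\<close> and signed radius \<open>s\<close> is recorded as
  \<open>(A, B, C) = (a - s, b, a + s)\<close>, and a directed point \<open>(x, y)\<close> whose unit normal has angle \<open>\<theta>\<close> as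
  \<open>(t, q, w) = (t, y - t x, x + t y)\<close> with \<open>t = tan (\<theta>/2)\<close>. Tangency becomes \<open>q = B - C t\<close>,
  \<open>w = A + B t\<close>: circles turn into lines of a linear complex in the space of the \<open>(t, q, w)\<close>, and
  dually directed points turn into light-like lines in the space of the \<open>(A, B, C)\<close>.

  On the dual side, three concurrent light-like lines are never coplanar, so a polynomial of degree
  \<open>O(m^(1/2))\<close> vanishing on all \<open>m\<close> of them yields, as in the joints problem, the bound
  \<open>O(m^(3/2) + n)\<close>. On the primal side the points are partitioned by a polynomial of degree \<open>O(D)\<close> into
  cells with at most \<open>m / D^3\<close> points, each line meeting \<open>O(D)\<close> cells; the dual bound in the cells sums
  to \<open>O(D n + m^(3/2) D^(-3/2))\<close>. The lines inside the zero set contribute only \<open>O(D n + m)\<close>,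
  because they are tangent to a contact distribution, which is nowhere integrable. The choice
  \<open>D = m^(3/5) n^(-2/5)\<close> balances the terms. The partition rests on a polynomial ham sandwich
  theorem, obtained from a Borsuk--Ulam theorem for homogeneous Lipschitz maps.\<close>

section \<open>Borsuk--Ulam for homogeneous Lipschitz maps\<close>

text \<open>Neither space serves alone. Lines of the complex through a common point all lie in the
  contact plane there, so a joints argument on the primal side gains nothing from three of them,
  while light-like lines through a common point lie on a quadratic cone. The partition, however, has
  to be made where directed points are points: the dual bound is superlinear only in the number of
  directed points, and this is the number that a cell makes small. Its exponent 3/2 arises because a
  polynomial of degree d, with about d^3 coefficients, is made to vanish at about d points on each
  of m lines. Irreducible factors, Bezout's theorem and tangent planes are avoided: on both sides a
  nonzero polynomial of least degree vanishing on a union of lines takes their place, since a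
  derivative that vanishes on the same lines is then identically zero.\<close>

text \<open>Functions of infinite sequences that see only the coordinates up to \<open>n\<close>,
  matching the encoding of spheres by \<open>nsphere\<close>. Negative \<open>t\<close> gives
  oddness, and homogeneity extends estimates from a compact sphere to the whole space. The Lipschitz
  bound allows a counting argument to show that a map into one more dimension is not onto.\<close>

definition hom_lipschitz :: "nat \<Rightarrow> ((nat \<Rightarrow> real) \<Rightarrow> real) \<Rightarrow> bool" where
  "hom_lipschitz n h \<longleftrightarrow>
     (\<exists>L\<ge>0. \<forall>x y. \<bar>h x - h y\<bar> \<le> L * (\<Sum>j\<le>n. \<bar>x j - y j\<bar>)) \<and>
     (\<forall>t x. h (\<lambda>j. t * x j) = t * h x)"

lemma hom_lipschitz_bound:
  assumes "hom_lipschitz n h"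
  obtains L where "L \<ge> 0" "\<And>x y. \<bar>h x - h y\<bar> \<le> L * (\<Sum>j\<le>n. \<bar>x j - y j\<bar>)"
  using assms by (auto simp: hom_lipschitz_def)

lemma hom_lipschitz_scale: "hom_lipschitz n h \<Longrightarrow> h (\<lambda>j. t * x j) = t * h x"
  by (auto simp: hom_lipschitz_def)

lemma hom_lipschitz_cong:
  assumes "hom_lipschitz n h" "\<And>j. j \<le> n \<Longrightarrow> x j = y j"
  shows "h x = h y"
proof -
  obtain L where L: "\<And>x y. \<bar>h x - h y\<bar> \<le> L * (\<Sum>j\<le>n. \<bar>x j - y j\<bar>)"
    using hom_lipschitz_bound [OF assms(1)] by blast
  have "(\<Sum>j\<le>n. \<bar>x j - y j\<bar>) = 0"
    using assms(2) by (intro sum.neutral) auto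
  then show ?thesis
    using L [of x y] by simp
qed

lemma hom_lipschitz_coord: "j \<le> n \<Longrightarrow> hom_lipschitz n (\<lambda>x. x j)"
  unfolding hom_lipschitz_def
  by (auto intro!: exI [of _ 1] member_le_sum [of j "{..n}" "\<lambda>j. \<bar>_ j - _ j\<bar>"])

lemma hom_lipschitz_zero: "hom_lipschitz n (\<lambda>x. 0)"
  unfolding hom_lipschitz_def by (auto intro!: exI [of _ 0])

lemma hom_lipschitz_add:
  assumes "hom_lipschitz n f" "hom_lipschitz n g"
  shows "hom_lipschitz n (\<lambda>x. f x + g x)"
proof -
  obtain L where L: "L \<ge> 0" "\<And>x y. \<bar>f x - f y\<bar> \<le> L * (\<Sum>j\<le>n. \<bar>x j - y j\<bar>)"
    using hom_lipschitz_bound [OF assms(1)] by blast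
  obtain M where M: "M \<ge> 0" "\<And>x y. \<bar>g x - g y\<bar> \<le> M * (\<Sum>j\<le>n. \<bar>x j - y j\<bar>)"
    using hom_lipschitz_bound [OF assms(2)] by blast
  have "\<bar>f x + g x - (f y + g y)\<bar> \<le> (L + M) * (\<Sum>j\<le>n. \<bar>x j - y j\<bar>)" for x y
    using L(2) [of x y] M(2) [of x y] by (simp add: algebra_simps)
  then show ?thesis
    using L(1) M(1) assms unfolding hom_lipschitz_def
    by (auto intro!: exI [of _ "L + M"] simp: algebra_simps)
qed

lemma hom_lipschitz_cmult:
  assumes "hom_lipschitz n f"
  shows "hom_lipschitz n (\<lambda>x. c * f x)"
proof -
  obtain L where L: "L \<ge> 0" "\<And>x y. \<bar>f x - f y\<bar> \<le> L * (\<Sum>j\<le>n. \<bar>x j - y j\<bar>)"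
    using hom_lipschitz_bound [OF assms(1)] by blast
  have "\<bar>c * f x - c * f y\<bar> \<le> (\<bar>c\<bar> * L) * (\<Sum>j\<le>n. \<bar>x j - y j\<bar>)" for x y
    using mult_left_mono [OF L(2) [of x y], of "\<bar>c\<bar>"]
    by (simp add: abs_mult [symmetric] right_diff_distrib mult.assoc)
  then show ?thesis
    using L(1) assms unfolding hom_lipschitz_def
    by (auto intro!: exI [of _ "\<bar>c\<bar> * L"] simp: algebra_simps)
qed

lemma hom_lipschitz_sum:
  assumes "\<And>i. i \<in> I \<Longrightarrow> hom_lipschitz n (f i)"
  shows "hom_lipschitz n (\<lambda>x. \<Sum>i\<in>I. f i x)"
  using assms
  by (induction I rule: infinite_finite_induct)
    (auto intro: hom_lipschitz_zero hom_lipschitz_add)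

text \<open>For \<open>b \<ge> 0\<close> the nearest point to \<open>t\<close> in the interval from
  \<open>-b\<close> to \<open>b\<close>. It occurs with \<open>b\<close> the absolute value of a
  coordinate, in the degree argument, and with \<open>b\<close> a multiple of the l1 norm, as a
  Lipschitz substitute for the sign function in the ham sandwich theorem. A fixed width would
  destroy homogeneity; these widths scale with the argument.\<close>

definition clamp_to :: "real \<Rightarrow> real \<Rightarrow> real" where
  "clamp_to b t = max (- b) (min b t)"

lemma clamp_to_diff: "\<bar>clamp_to b s - clamp_to c t\<bar> \<le> \<bar>b - c\<bar> + \<bar>s - t\<bar>"
  unfolding clamp_to_def by linarith

lemma clamp_to_scale:
  assumes "b \<ge> 0"
  shows "clamp_to (\<bar>t\<bar> * b) (t * s) = t * clamp_to b s"
proof (cases "t \<ge> 0")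
  case True
  then show ?thesis
    by (simp add: clamp_to_def max_mult_distrib_left min_mult_distrib_left)
next
  case False
  have m: "clamp_to b (- s) = - clamp_to b s" for s
    using assms unfolding clamp_to_def by linarith
  have "clamp_to (- t * b) (- t * - s) = - t * clamp_to b (- s)"
    using False by (simp add: clamp_to_def max_mult_distrib_left min_mult_distrib_left)
  then show ?thesis
    using False m [of s] by simp
qed

lemma hom_lipschitz_clamp_to:
  assumes f: "hom_lipschitz n f"
    and b: "\<And>x y. \<bar>b x - b y\<bar> \<le> M * (\<Sum>j\<le>n. \<bar>x j - y j\<bar>)" "\<And>t x. b (\<lambda>j. t * x j) = \<bar>t\<bar> * b x"
      "\<And>x. b x \<ge> 0" "M \<ge> 0"
  shows "hom_lipschitz n (\<lambda>x. clamp_to (b x) (f x))"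
proof -
  obtain L where L: "L \<ge> 0" "\<And>x y. \<bar>f x - f y\<bar> \<le> L * (\<Sum>j\<le>n. \<bar>x j - y j\<bar>)"
    using hom_lipschitz_bound [OF f] by blast
  have "\<bar>clamp_to (b x) (f x) - clamp_to (b y) (f y)\<bar> \<le> (M + L) * (\<Sum>j\<le>n. \<bar>x j - y j\<bar>)" for x y
    using clamp_to_diff [of "b x" "f x" "b y" "f y"] L(2) [of x y] b(1) [of x y]
    by (simp add: algebra_simps)
  then show ?thesis
    using L(1) b f unfolding hom_lipschitz_def
    by (auto intro!: exI [of _ "M + L"] simp: clamp_to_scale)
qed

lemma hom_lipschitz_continuous:
  assumes "hom_lipschitz n h"
  shows "continuous_on UNIV h"
proof -
  obtain L where L: "L \<ge> 0" "\<And>x y. \<bar>h x - h y\<bar> \<le> L * (\<Sum>j\<le>n. \<bar>x j - y j\<bar>)"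
    using hom_lipschitz_bound [OF assms] by blast
  have "(h \<longlongrightarrow> h x) (at x)" for x
  proof -
    have "((\<lambda>y. y j) \<longlongrightarrow> x j) (at x)" for j
      using continuous_on_product_coordinates [of j] unfolding continuous_on_def by auto
    then have "((\<lambda>y. L * (\<Sum>j\<le>n. \<bar>y j - x j\<bar>)) \<longlongrightarrow> L * (\<Sum>j\<le>n. \<bar>x j - x j\<bar>)) (at x)"
      by (intro tendsto_intros)
    then have "((\<lambda>y. L * (\<Sum>j\<le>n. \<bar>y j - x j\<bar>)) \<longlongrightarrow> 0) (at x)"
      by simp
    then have "((\<lambda>y. h y - h x) \<longlongrightarrow> 0) (at x)"
      by (rule Lim_null_comparison [rotated]) (use L(2) in auto)
    then show ?thesis
      by (simp add: LIM_zero_iff)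
  qed
  then show ?thesis
    by (simp add: continuous_on_def)
qed

section \<open>Compactness of the l1 sphere and maps without zeros\<close>

lemma compact_cube: "compact {x::nat \<Rightarrow> real. \<forall>i. \<bar>x i\<bar> \<le> 1}"
proof -
  have "compactin (powertop_real UNIV) (\<Pi>\<^sub>E i\<in>UNIV. {-1..1::real})"
    by (simp add: compactin_PiE)
  moreover have "(\<Pi>\<^sub>E i\<in>UNIV. {-1..1::real}) = {x::nat \<Rightarrow> real. \<forall>i. \<bar>x i\<bar> \<le> 1}"
  proof -
    have "(u \<in> {-1..1}) = (\<bar>u\<bar> \<le> 1)" for u :: real
      by auto
    then show ?thesis by (auto simp only: set_eq_iff PiE_UNIV_domain Pi_iff mem_Collect_eq UNIV_I)
  qed
  ultimately show ?thesis
    by (metis compactin_euclidean_iff euclidean_product_topology)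
qed

lemma closed_coord_zero: "closed {x::nat \<Rightarrow> real. \<forall>i>n. x i = 0}"
  by (intro closed_Collect_all closed_Collect_imp open_Collect_const closed_Collect_eq
      continuous_on_product_coordinates continuous_on_const)

lemma compact_l1_sphere:
  "compact ({x::nat \<Rightarrow> real. \<forall>i. \<bar>x i\<bar> \<le> 1} \<inter> ({x. \<forall>i>n. x i = 0} \<inter> {x. (\<Sum>j\<le>n. \<bar>x j\<bar>) = 1}))"
  by (intro compact_Int_closed compact_cube closed_Int closed_coord_zero closed_Collect_eq
      continuous_intros continuous_on_product_coordinates)

text \<open>The continuous function on the right attains a positive minimum on the compact l1
  sphere, and homogeneity carries the bound to all \<open>x\<close>. It serves to bound the
  preimages of a bounded set.\<close>

lemma nonvanishing_lower_bound:
  fixes H :: "(nat \<Rightarrow> real) \<Rightarrow> nat \<Rightarrow> real"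
  assumes H: "\<And>i. i \<le> k \<Longrightarrow> hom_lipschitz n (\<lambda>x. H x i)"
    and nz: "\<And>x. \<exists>j\<le>n. x j \<noteq> 0 \<Longrightarrow> \<exists>i\<le>k. H x i \<noteq> 0"
  obtains \<delta> where "\<delta> > 0" "\<And>x. \<delta> * (\<Sum>j\<le>n. \<bar>x j\<bar>) \<le> (\<Sum>i\<le>k. \<bar>H x i\<bar>)"
proof -
  define K where "K = {x::nat \<Rightarrow> real. \<forall>i. \<bar>x i\<bar> \<le> 1} \<inter> ({x. \<forall>i>n. x i = 0} \<inter> {x. (\<Sum>j\<le>n. \<bar>x j\<bar>) = 1})"
  have "compact K" unfolding K_def by (rule compact_l1_sphere)
  moreover have "(\<lambda>i. if i = 0 then 1 else 0) \<in> K"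
    by (auto simp: K_def if_distrib [of abs] cong: if_cong)
  then have "K \<noteq> {}" by auto
  moreover have "continuous_on K (\<lambda>x. \<Sum>i\<le>k. \<bar>H x i\<bar>)"
    by (intro continuous_intros continuous_on_subset [OF hom_lipschitz_continuous [OF H]]) auto
  ultimately have "\<exists>z\<in>K. \<forall>y\<in>K. (\<Sum>i\<le>k. \<bar>H z i\<bar>) \<le> (\<Sum>i\<le>k. \<bar>H y i\<bar>)"
    by (rule continuous_attains_inf)
  then obtain z where z: "z \<in> K" "\<And>y. y \<in> K \<Longrightarrow> (\<Sum>i\<le>k. \<bar>H z i\<bar>) \<le> (\<Sum>i\<le>k. \<bar>H y i\<bar>)"
    by auto
  define \<delta> where "\<delta> = (\<Sum>i\<le>k. \<bar>H z i\<bar>)"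
  have "\<exists>j\<le>n. z j \<noteq> 0"
  proof (rule ccontr)
    assume "\<not> ?thesis"
    then have "(\<Sum>j\<le>n. \<bar>z j\<bar>) = 0" by (intro sum.neutral) auto
    with z(1) show False by (simp add: K_def)
  qed
  then obtain i where i: "i \<le> k" "H z i \<noteq> 0" using nz by blast
  have "\<bar>H z i\<bar> \<le> \<delta>"
    unfolding \<delta>_def by (rule member_le_sum) (use i in auto)
  then have "\<delta> > 0" using i by linarith
  moreover have "\<delta> * (\<Sum>j\<le>n. \<bar>x j\<bar>) \<le> (\<Sum>i\<le>k. \<bar>H x i\<bar>)" for x
  proof (cases "(\<Sum>j\<le>n. \<bar>x j\<bar>) = 0")
    case True
    then show ?thesis by (simp add: sum_nonneg)
  next
    case False
    define s where "s = (\<Sum>j\<le>n. \<bar>x j\<bar>)"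
    have s: "s > 0" using False unfolding s_def by (simp add: order.not_eq_order_implies_strict sum_nonneg)
    define y where "y = (\<lambda>j. if j \<le> n then x j / s else 0)"
    have sy: "(\<Sum>j\<le>n. \<bar>y j\<bar>) = 1"
      using s by (simp add: y_def s_def sum_divide_distrib [symmetric])
    have "\<bar>y j\<bar> \<le> 1" for j
    proof (cases "j \<le> n")
      case True
      then have "\<bar>y j\<bar> \<le> (\<Sum>j\<le>n. \<bar>y j\<bar>)" by (intro member_le_sum) auto
      then show ?thesis using sy by simp
    qed (simp add: y_def)
    then have "y \<in> K" using sy by (simp add: K_def y_def)
    have "H y i = H x i / s" if "i \<le> k" for i
    proof -
      have "H y i = H (\<lambda>j. (1/s) * x j) i"
        by (rule hom_lipschitz_cong [OF H [OF that]]) (simp add: y_def)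
      then show ?thesis
        using hom_lipschitz_scale [OF H [OF that], of "1/s" x] by simp
    qed
    then have "(\<Sum>i\<le>k. \<bar>H y i\<bar>) = (\<Sum>i\<le>k. \<bar>H x i\<bar>) / s"
      using s by (simp add: sum_divide_distrib)
    then show ?thesis
      using mult_left_mono [OF z(2) [OF \<open>y \<in> K\<close>], of s] s by (simp add: \<delta>_def field_simps flip: s_def)
  qed
  ultimately show thesis using that by blast
qed

text \<open>Of the \<open>M^(n+2)\<close> points of a fine grid with spacing \<open>1/M\<close>, only \<open>O(M^(n+1))\<close> can be hit.\<close>

lemma hom_lipschitz_missed_point:
  fixes H :: "(nat \<Rightarrow> real) \<Rightarrow> nat \<Rightarrow> real"
  assumes H: "\<And>i. i \<le> Suc n \<Longrightarrow> hom_lipschitz n (\<lambda>x. H x i)"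
    and nz: "\<And>x. \<exists>j\<le>n. x j \<noteq> 0 \<Longrightarrow> \<exists>i\<le>Suc n. H x i \<noteq> 0"
  shows "\<exists>a. a (Suc n) \<noteq> 0 \<and> (\<forall>x. \<exists>i\<le>Suc n. H x i \<noteq> a i)"
proof (rule ccontr)
  assume "\<not> ?thesis"
  then have surj: "\<exists>x. \<forall>i\<le>Suc n. H x i = a i" if "a (Suc n) \<noteq> 0" for a
    using that by blast
  obtain \<delta> where \<delta>: "\<delta> > 0" "\<And>x. \<delta> * (\<Sum>j\<le>n. \<bar>x j\<bar>) \<le> (\<Sum>i\<le>Suc n. \<bar>H x i\<bar>)"
    using nonvanishing_lower_bound [OF H nz] by blast
  have "\<forall>i\<in>{..Suc n}. \<exists>L\<ge>0. \<forall>x y. \<bar>H x i - H y i\<bar> \<le> L * (\<Sum>j\<le>n. \<bar>x j - y j\<bar>)"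
    using H unfolding hom_lipschitz_def by auto
  then have "\<exists>L. \<forall>i\<in>{..Suc n}. 0 \<le> L i \<and> (\<forall>x y. \<bar>H x i - H y i\<bar> \<le> L i * (\<Sum>j\<le>n. \<bar>x j - y j\<bar>))"
    by (rule bchoice)
  then obtain L where "\<forall>i\<in>{..Suc n}. 0 \<le> L i \<and> (\<forall>x y. \<bar>H x i - H y i\<bar> \<le> L i * (\<Sum>j\<le>n. \<bar>x j - y j\<bar>))"
    by (elim exE)
  then have L: "\<And>i. i \<le> Suc n \<Longrightarrow> L i \<ge> 0"
      "\<And>i x y. i \<le> Suc n \<Longrightarrow> \<bar>H x i - H y i\<bar> \<le> L i * (\<Sum>j\<le>n. \<bar>x j - y j\<bar>)"
    by auto
  define L' where "L' = (\<Sum>i\<le>Suc n. L i)"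
  have L'_nonneg: "L' \<ge> 0" unfolding L'_def by (rule sum_nonneg) (use L(1) in auto)
  have LL': "L i \<le> L'" if "i \<le> Suc n" for i
    unfolding L'_def by (rule member_le_sum) (use that L(1) in auto)
  \<comment> \<open>\<open>b\<close> makes the domain grid so fine that two preimages in one cube of
    side \<open>1 / (M * b)\<close> have images less than \<open>1 / M\<close> apart;
    \<open>c\<close> bounds the coordinates of all preimages; \<open>M\<close> is chosen last, so
    that \<open>M ^ (n + 2)\<close> exceeds \<open>((2 * c * b + 1) * M) ^ Suc n\<close>.\<close>
  obtain b :: nat where b: "real b > L' * (real n + 1)" using reals_Archimedean2 by blast
  obtain c :: nat where c: "real c > (real n + 2) / \<delta>" using reals_Archimedean2 by blast
  define M where "M = Suc ((2 * c * b + 1) ^ Suc n)"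
  have b0: "b > 0" using b L'_nonneg
    by (metis add_nonneg_pos gr0I mult_nonneg_nonneg not_less of_nat_0 of_nat_0_le_iff order_less_imp_le zero_less_one)
  have M0: "M > 0" by (simp add: M_def)
  \<comment> \<open>The grid starts at 1, not 0, so that the last coordinate of every grid point is
    nonzero and the assumed preimage exists.\<close>
  define G where "G = (\<Pi>\<^sub>E i\<in>{..Suc n}. {1..M})"
  define a where "a g = (\<lambda>i. real (g i) / real M)" for g :: "nat \<Rightarrow> nat"
  have "\<exists>x. \<forall>i\<le>Suc n. H x i = a g i" if "g \<in> G" for g
  proof (rule surj)
    have "g (Suc n) \<ge> 1" using that by (auto simp: G_def PiE_def Pi_def)
    then show "a g (Suc n) \<noteq> 0" using M0 by (simp add: a_def)
  qed
  then obtain X where X: "\<And>g i. g \<in> G \<Longrightarrow> i \<le> Suc n \<Longrightarrow> H (X g) i = a g i" by metis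
  define cell where "cell g = (\<lambda>j\<in>{..n}. \<lfloor>X g j * real (M * b)\<rfloor>)" for g
  define B where "B = int (c * (M * b))"
  have Xb: "\<bar>X g j\<bar> \<le> real c" if g: "g \<in> G" and j: "j \<le> n" for g j
  proof -
    have "\<bar>H (X g) i\<bar> \<le> 1" if "i \<le> Suc n" for i
    proof -
      have "g i \<le> M" using g that by (auto simp: G_def PiE_def Pi_def)
      then show ?thesis using M0 X [OF g that] by (simp add: a_def)
    qed
    then have "(\<Sum>i\<le>Suc n. \<bar>H (X g) i\<bar>) \<le> (\<Sum>i\<le>Suc n. 1)" by (intro sum_mono) auto
    then have "\<delta> * (\<Sum>j\<le>n. \<bar>X g j\<bar>) \<le> real n + 2" using \<delta>(2) [of "X g"] by simp
    then have "(\<Sum>j\<le>n. \<bar>X g j\<bar>) \<le> (real n + 2) / \<delta>" using \<delta>(1) by (simp add: field_simps)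
    moreover have "\<bar>X g j\<bar> \<le> (\<Sum>j\<le>n. \<bar>X g j\<bar>)"
      by (rule member_le_sum) (use j in auto)
    ultimately show ?thesis using c by linarith
  qed
  have "cell ` G \<subseteq> (\<Pi>\<^sub>E j\<in>{..n}. {-B..B})"
  proof (clarsimp simp: cell_def)
    fix g j assume g: "g \<in> G" and j: "j \<le> n"
    have "\<bar>X g j * (real M * real b)\<bar> \<le> real c * (real M * real b)"
      using Xb [OF g j] by (simp add: abs_mult mult_right_mono)
    then have *: "- real_of_int B \<le> X g j * (real M * real b)" "X g j * (real M * real b) \<le> real_of_int B"
      by (auto simp: B_def abs_le_iff)
    show "- B \<le> \<lfloor>X g j * (real M * real b)\<rfloor> \<and> \<lfloor>X g j * (real M * real b)\<rfloor> \<le> B"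
      using * by (simp add: le_floor_iff floor_le_iff)
  qed
  moreover have "inj_on cell G"
  proof (rule inj_onI)
    fix g h assume g: "g \<in> G" and h: "h \<in> G" and eq: "cell g = cell h"
    have Mb: "real (M * b) > 0" using M0 b0 by simp
    have "\<bar>X g j - X h j\<bar> \<le> 1 / real (M * b)" if "j \<le> n" for j
    proof -
      have "\<lfloor>X g j * real (M * b)\<rfloor> = \<lfloor>X h j * real (M * b)\<rfloor>"
        using fun_cong [OF eq, of j] that by (simp add: cell_def)
      then have "\<bar>X g j * real (M * b) - X h j * real (M * b)\<bar> \<le> 1" by linarith
      then have "\<bar>X g j - X h j\<bar> * real (M * b) \<le> 1"
        using Mb by (simp add: abs_mult flip: left_diff_distrib)
      then show ?thesis using Mb by (simp add: field_simps)
    qed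
    then have "(\<Sum>j\<le>n. \<bar>X g j - X h j\<bar>) \<le> (\<Sum>j\<le>n. 1 / real (M * b))" by (intro sum_mono) auto
    then have S: "(\<Sum>j\<le>n. \<bar>X g j - X h j\<bar>) \<le> (real n + 1) / real (M * b)" by (simp add: add.commute)
    have "g i = h i" if i: "i \<le> Suc n" for i
    proof -
      have "\<bar>a g i - a h i\<bar> \<le> L i * (\<Sum>j\<le>n. \<bar>X g j - X h j\<bar>)"
        using L(2) [OF i, of "X g" "X h"] X g h i by simp
      also have "\<dots> \<le> L' * ((real n + 1) / real (M * b))"
        using S L(1) [OF i] LL' [OF i] by (intro mult_mono) (auto intro: sum_nonneg)
      also have "\<dots> = L' * (real n + 1) / (real M * real b)" by simp
      also have "\<dots> < real b / (real M * real b)"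
        using b Mb by (intro divide_strict_right_mono) auto
      also have "\<dots> = 1 / real M" using b0 by simp
      finally have "\<bar>real (g i) - real (h i)\<bar> / real M < 1 / real M"
        by (simp add: a_def flip: diff_divide_distrib)
      then have "\<bar>real (g i) - real (h i)\<bar> < 1" using M0 by (simp add: divide_less_cancel)
      then show ?thesis by linarith
    qed
    then show "g = h"
      using g h unfolding G_def by (intro PiE_ext) auto
  qed
  moreover have "finite (\<Pi>\<^sub>E j\<in>{..n}. {-B..B})" by (intro finite_PiE) auto
  ultimately have "card G \<le> card (\<Pi>\<^sub>E j\<in>{..n}. {-B..B})"
    by (metis card_image card_mono)
  then have "M ^ (n + 2) \<le> nat (2 * B + 1) ^ Suc n"
    by (simp add: G_def card_PiE)
  also have "nat (2 * B + 1) = 2 * (c * (M * b)) + 1"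
    by (simp add: B_def nat_add_distrib nat_mult_distrib)
  also have "(2 * (c * (M * b)) + 1) ^ Suc n \<le> ((2 * c * b + 1) * M) ^ Suc n"
    using M0 by (intro power_mono) (auto simp: algebra_simps)
  finally have "M * M ^ Suc n \<le> (2 * c * b + 1) ^ Suc n * M ^ Suc n"
    by (simp only: power_mult_distrib power_Suc add_2_eq_Suc' mult_ac)
  moreover have "M ^ Suc n > 0" using M0 by simp
  ultimately have "M \<le> (2 * c * b + 1) ^ Suc n" by (metis mult_le_cancel2)
  then show False by (simp add: M_def)
qed

section \<open>Normalized maps of spheres and their degree\<close>

lemma continuous_map_hom_lipschitz:
  assumes "hom_lipschitz n h"
  shows "continuous_map (nsphere m) euclideanreal h"
proof -
  have "continuous_map (powertop_real UNIV) euclideanreal h"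
    using hom_lipschitz_continuous [OF assms]
    by (metis continuous_map_iff_continuous2 euclidean_product_topology)
  then show ?thesis
    unfolding nsphere by (rule continuous_map_from_subtopology)
qed

text \<open>Radial projection of a nowhere vanishing \<open>H\<close> to the unit sphere. The domain
  is an arbitrary type so that a homotopy, a map on a product with the unit interval, can be
  normalized in the same way.\<close>

definition normalize_map :: "nat \<Rightarrow> ('a \<Rightarrow> nat \<Rightarrow> real) \<Rightarrow> 'a \<Rightarrow> nat \<Rightarrow> real" where
  "normalize_map n H x = (\<lambda>i. if i \<le> n then H x i / sqrt (\<Sum>j\<le>n. (H x j)\<^sup>2) else 0)"

lemma continuous_map_normalize_map:
  assumes "\<And>i. i \<le> n \<Longrightarrow> continuous_map X euclideanreal (\<lambda>x. H x i)"
    and "\<And>x. x \<in> topspace X \<Longrightarrow> \<exists>i\<le>n. H x i \<noteq> 0"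
  shows "continuous_map X (nsphere n) (normalize_map n H)"
proof -
  have pos: "(\<Sum>j\<le>n. (H x j)\<^sup>2) > 0" if x: "x \<in> topspace X" for x
  proof -
    obtain i where "i \<le> n" "H x i \<noteq> 0" using assms(2) [OF x] by blast
    then show ?thesis by (intro sum_pos2 [of _ i]) auto
  qed
  have "continuous_map X euclideanreal (\<lambda>x. normalize_map n H x i)" for i
  proof (cases "i \<le> n")
    case True
    have "continuous_map X euclideanreal (\<lambda>x. H x i / sqrt (\<Sum>j\<le>n. (H x j)\<^sup>2))"
      using pos True by (intro continuous_intros assms(1)) fastforce+
    then show ?thesis using True by (simp add: normalize_map_def)
  qed (simp add: normalize_map_def)
  moreover have "(\<Sum>i\<le>n. (normalize_map n H x i)\<^sup>2) = 1" if "x \<in> topspace X" for x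
  proof -
    have "(\<Sum>i\<le>n. (normalize_map n H x i)\<^sup>2) = (\<Sum>i\<le>n. (H x i)\<^sup>2 / (\<Sum>j\<le>n. (H x j)\<^sup>2))"
      using pos [OF that] by (intro sum.cong) (auto simp: normalize_map_def power_divide)
    also have "\<dots> = 1" using pos [OF that] by (simp flip: sum_divide_distrib)
    finally show ?thesis .
  qed
  ultimately show ?thesis
    by (auto simp: nsphere continuous_map_in_subtopology continuous_map_componentwise_UNIV normalize_map_def)
qed

lemma homotopic_normalize_map:
  fixes X :: "'a topology"
  assumes "\<And>i. i \<le> n \<Longrightarrow> continuous_map X euclideanreal (\<lambda>x. H x i)"
    and "\<And>i. i \<le> n \<Longrightarrow> continuous_map X euclideanreal (\<lambda>x. H' x i)"
    and "\<And>t x. t \<in> {0..1} \<Longrightarrow> x \<in> topspace X \<Longrightarrow> \<exists>i\<le>n. (1 - t) * H x i + t * H' x i \<noteq> 0"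
  shows "homotopic_with (\<lambda>x. True) X (nsphere n) (normalize_map n H) (normalize_map n H')"
proof -
  define G where "G = (\<lambda>(t, x) i. (1 - t) * H x i + t * H' x i)"
  have fst: "continuous_map (prod_topology (top_of_set {0..1::real}) X) euclideanreal fst"
    by (metis continuous_map_fst continuous_map_into_fulltopology)
  have c: "continuous_map (prod_topology (top_of_set {0..1::real}) X) euclideanreal (\<lambda>z. K (snd z) i)"
    if "continuous_map X euclideanreal (\<lambda>x. K x i)" for K and i :: nat
    using continuous_map_compose [OF continuous_map_snd that] by (simp add: o_def)
  have "continuous_map (prod_topology (top_of_set {0..1}) X) (nsphere n) (normalize_map n G)"
  proof (rule continuous_map_normalize_map)
    fix i assume i: "i \<le> n"
    show "continuous_map (prod_topology (top_of_set {0..1}) X) euclideanreal (\<lambda>x. G x i)"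
      unfolding G_def case_prod_unfold
      by (intro continuous_map_add continuous_map_real_mult continuous_map_diff fst c assms i) auto
  next
    fix z :: "real \<times> 'a" assume "z \<in> topspace (prod_topology (top_of_set {0..1}) X)"
    then show "\<exists>i\<le>n. G z i \<noteq> 0"
      using assms(3) by (auto simp: G_def split: prod.splits)
  qed
  then show ?thesis
    unfolding homotopic_with_def
    by (intro exI [of _ "normalize_map n G"]) (auto simp: normalize_map_def G_def)
qed

lemma topspace_nsphere_nonzero:
  assumes "x \<in> topspace (nsphere n)"
  shows "\<exists>j\<le>n. x j \<noteq> 0"
proof (rule ccontr)
  assume "\<not> ?thesis"
  then have "(\<Sum>j\<le>n. (x j)\<^sup>2) = 0" by (intro sum.neutral) auto
  then show False using assms by (simp add: nsphere)
qed

text \<open>The library's degree theorem for odd maps assumes that the map preserves the equator. Restricted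
  to the equator, \<open>H\<close> misses a line spanned by some \<open>a\<close>; after a shear that turns \<open>a\<close> into the polar
  axis, the last component can be clamped by \<open>\<bar>x\<^sub>n\<bar>\<close> along a linear homotopy without zeros.\<close>

theorem odd_degree_normalize_map:
  assumes "\<And>i. i \<le> n \<Longrightarrow> hom_lipschitz n (\<lambda>x. H x i)"
    and "\<And>x. \<exists>j\<le>n. x j \<noteq> 0 \<Longrightarrow> \<exists>i\<le>n. H x i \<noteq> 0"
  shows "odd (Brouwer_degree2 n (normalize_map n H))"
  using assms
proof (induction n arbitrary: H)
  case 0
  define c where "c = H (\<lambda>_. 1) 0"
  have c: "c \<noteq> 0" using "0.prems"(2) [of "\<lambda>_. 1"] by (simp add: c_def)
  have H: "H x 0 = x 0 * c" for x
  proof -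
    have "H x 0 = H (\<lambda>j. x 0 * 1) 0"
      by (rule hom_lipschitz_cong [OF "0.prems"(1)]) auto
    then show ?thesis
      using hom_lipschitz_scale [OF "0.prems"(1) [of 0], of "x 0" "\<lambda>_. 1"] by (simp add: c_def)
  qed
  have N: "normalize_map 0 H x = (if c > 0 then x else (\<lambda>i. if i = 0 then - x i else x i))"
    if "x \<in> topspace (nsphere 0)" for x
  proof -
    have x: "x 0 = 1 \<or> x 0 = -1" "\<And>i. i > 0 \<Longrightarrow> x i = 0"
      using that by (auto simp: nsphere power2_eq_1_iff)
    then show ?thesis
      using c by (auto simp: normalize_map_def H fun_eq_iff)
  qed
  show ?case
  proof (cases "c > 0")
    case True
    then have "Brouwer_degree2 0 (normalize_map 0 H) = Brouwer_degree2 0 id"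
      using N by (intro Brouwer_degree2_eq) auto
    then show ?thesis by simp
  next
    case False
    then have "Brouwer_degree2 0 (normalize_map 0 H) = Brouwer_degree2 0 (\<lambda>x i. if i = 0 then - x i else x i)"
      using N by (intro Brouwer_degree2_eq) auto
    then show ?thesis by (simp add: Brouwer_degree2_reflection)
  qed
next
  case (Suc n)
  \<comment> \<open>Composition with \<open>trunc\<close> restricts a map to the equator and lets it
    count as a map of one variable fewer.\<close>
  define trunc where "trunc x = (\<lambda>j. if j \<le> n then x j else 0)" for x :: "nat \<Rightarrow> real"
  have trunc_lip: "hom_lipschitz n (\<lambda>x. h (trunc x))" if h: "hom_lipschitz (Suc n) h" for h
  proof -
    obtain L where L: "L \<ge> 0" "\<And>x y. \<bar>h x - h y\<bar> \<le> L * (\<Sum>j\<le>Suc n. \<bar>x j - y j\<bar>)"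
      using hom_lipschitz_bound [OF h] by blast
    have "\<bar>h (trunc x) - h (trunc y)\<bar> \<le> L * (\<Sum>j\<le>n. \<bar>x j - y j\<bar>)" for x y
      using L(2) [of "trunc x" "trunc y"] by (simp add: trunc_def)
    moreover have "trunc (\<lambda>j. t * x j) = (\<lambda>j. t * trunc x j)" for t x
      by (auto simp: trunc_def)
    ultimately show ?thesis
      using L(1) h unfolding hom_lipschitz_def by auto
  qed
  have trunc_nz: "\<exists>j\<le>Suc n. trunc x j \<noteq> 0" if "\<exists>j\<le>n. x j \<noteq> 0" for x
    using that by (auto simp: trunc_def intro: le_SucI)
  have "\<exists>a. a (Suc n) \<noteq> 0 \<and> (\<forall>x. \<exists>i\<le>Suc n. H (trunc x) i \<noteq> a i)"
  proof (rule hom_lipschitz_missed_point)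
    show "hom_lipschitz n (\<lambda>x. H (trunc x) i)" if "i \<le> Suc n" for i
      using trunc_lip [OF Suc.prems(1) [OF that]] .
    show "\<exists>i\<le>Suc n. H (trunc x) i \<noteq> 0" if "\<exists>j\<le>n. x j \<noteq> 0" for x
      using Suc.prems(2) [OF trunc_nz [OF that]] .
  qed
  then obtain a where a: "a (Suc n) \<noteq> 0" "\<And>x. \<exists>i\<le>Suc n. H (trunc x) i \<noteq> a i"
    by (elim exE conjE) auto
  define H' where "H' x i = (if i \<le> n then H x i + (- (a i / a (Suc n))) * H x (Suc n)
                             else clamp_to \<bar>x (Suc n)\<bar> (H x (Suc n)))" for x i
  have H': "hom_lipschitz (Suc n) (\<lambda>x. H' x i)" if i: "i \<le> Suc n" for i
  proof (cases "i \<le> n")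
    case True
    have "hom_lipschitz (Suc n) (\<lambda>x. H x i + (- (a i / a (Suc n))) * H x (Suc n))"
      by (intro hom_lipschitz_add hom_lipschitz_cmult Suc.prems) (use i in auto)
    then show ?thesis using True by (simp add: H'_def)
  next
    case False
    have "hom_lipschitz (Suc n) (\<lambda>x. clamp_to \<bar>x (Suc n)\<bar> (H x (Suc n)))"
    proof (rule hom_lipschitz_clamp_to [where M = 1])
      fix x y :: "nat \<Rightarrow> real"
      have "\<bar>\<bar>x (Suc n)\<bar> - \<bar>y (Suc n)\<bar>\<bar> \<le> \<bar>x (Suc n) - y (Suc n)\<bar>" by linarith
      also have "\<dots> \<le> 1 * (\<Sum>j\<le>Suc n. \<bar>x j - y j\<bar>)" by (simp add: sum_nonneg)
      finally show "\<bar>\<bar>x (Suc n)\<bar> - \<bar>y (Suc n)\<bar>\<bar> \<le> 1 * (\<Sum>j\<le>Suc n. \<bar>x j - y j\<bar>)" .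
    qed (auto simp: abs_mult intro: Suc.prems)
    then show ?thesis using False by (simp add: H'_def)
  qed
  have clamp0: "clamp_to 0 h = 0" for h by (simp add: clamp_to_def)
  have nz: "\<exists>i\<le>Suc n. (1 - t) * H x i + t * H' x i \<noteq> 0"
    if x: "\<exists>j\<le>Suc n. x j \<noteq> 0" and t: "t \<in> {0..1}" for x t
  proof (rule ccontr)
    assume "\<not> ?thesis"
    then have z: "\<And>i. i \<le> Suc n \<Longrightarrow> (1 - t) * H x i + t * H' x i = 0" by blast
    define h where "h = H x (Suc n)"
    have hz: "(1 - t) * h + t * clamp_to \<bar>x (Suc n)\<bar> h = 0"
      using z [of "Suc n"] by (simp add: H'_def h_def)
    show False
    proof (cases "h = 0")
      case True
      have "H x i = 0" if "i \<le> Suc n" for i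
        using z [OF that] True that by (cases "i = Suc n") (auto simp: H'_def h_def algebra_simps)
      then show False using Suc.prems(2) [OF x] by blast
    next
      case False
      \<comment> \<open>The clamped value never has the sign opposite to \<open>h\<close>, so the
        convex combination can vanish only if all the weight lies on the clamp and the clamp itself
        is 0, which for nonzero \<open>h\<close> happens on the equator alone.\<close>
      have "t = 1 \<and> x (Suc n) = 0"
      proof (rule ccontr)
        assume c: "\<not> ?thesis"
        have pos: "(1 - t) * p + t * q > 0" if "p > 0" "q \<ge> 0" "t = 1 \<Longrightarrow> q > 0" for p q
          using that t by (cases "t = 1") (auto intro!: add_pos_nonneg)
        show False
        proof (cases "h > 0")
          case True
          have "clamp_to \<bar>x (Suc n)\<bar> h \<ge> 0" "x (Suc n) \<noteq> 0 \<Longrightarrow> clamp_to \<bar>x (Suc n)\<bar> h > 0"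
            using True by (auto simp: clamp_to_def)
          then have "(1 - t) * h + t * clamp_to \<bar>x (Suc n)\<bar> h > 0"
            using c True by (intro pos) auto
          then show False using hz by simp
        next
          case False
          then have h: "- h > 0" using \<open>h \<noteq> 0\<close> by simp
          have "- clamp_to \<bar>x (Suc n)\<bar> h \<ge> 0" "x (Suc n) \<noteq> 0 \<Longrightarrow> - clamp_to \<bar>x (Suc n)\<bar> h > 0"
            using h unfolding clamp_to_def by linarith+
          then have "(1 - t) * (- h) + t * (- clamp_to \<bar>x (Suc n)\<bar> h) > 0"
            using c h by (intro pos) auto
          then show False using hz by simp
        qed
      qed
      then have t1: "t = 1" and x0: "x (Suc n) = 0" by auto
      \<comment> \<open>In the remaining case the sheared components vanish, so \<open>H x\<close>
        is proportional to \<open>a\<close>; the factor \<open>s\<close> makes the last components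
        agree. Then \<open>a\<close> would be a value of \<open>H\<close> on the equator, which it
        was chosen not to be.\<close>
      define s where "s = a (Suc n) / h"
      have "H (trunc (\<lambda>j. s * x j)) i = a i" if i: "i \<le> Suc n" for i
      proof -
        have "H (trunc (\<lambda>j. s * x j)) i = H (\<lambda>j. s * x j) i"
          by (rule hom_lipschitz_cong [OF Suc.prems(1) [OF i]])
            (use x0 in \<open>auto simp: trunc_def le_Suc_eq\<close>)
        also have "\<dots> = s * H x i"
          by (rule hom_lipschitz_scale [OF Suc.prems(1) [OF i]])
        also have "\<dots> = a i"
        proof (cases "i = Suc n")
          case True
          then show ?thesis using \<open>h \<noteq> 0\<close> by (simp add: s_def h_def)
        next
          case False
          then have "H x i = a i / a (Suc n) * h"
            using z [OF i] i t1 by (simp add: H'_def h_def)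
          then show ?thesis using \<open>h \<noteq> 0\<close> a(1) by (simp add: s_def)
        qed
        finally show ?thesis .
      qed
      then show False using a(2) by blast
    qed
  qed
  have cH: "continuous_map (nsphere (Suc n)) euclideanreal (\<lambda>x. H x i)"
    and cH': "continuous_map (nsphere (Suc n)) euclideanreal (\<lambda>x. H' x i)" if "i \<le> Suc n" for i
    using continuous_map_hom_lipschitz Suc.prems(1) H' that by blast+
  have nzH': "\<exists>i\<le>Suc n. H' x i \<noteq> 0" if "\<exists>j\<le>Suc n. x j \<noteq> 0" for x
    using nz [OF that, of 1] by simp
  define f where "f = normalize_map (Suc n) H'"
  have "homotopic_with (\<lambda>x. True) (nsphere (Suc n)) (nsphere (Suc n)) (normalize_map (Suc n) H) f"
    unfolding f_def
    by (intro homotopic_normalize_map cH cH' nz topspace_nsphere_nonzero)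
  then have deg: "Brouwer_degree2 (Suc n) (normalize_map (Suc n) H) = Brouwer_degree2 (Suc n) f"
    by (rule Brouwer_degree2_homotopic)
  have cf: "continuous_map (nsphere (Suc n)) (nsphere (Suc n)) f"
    unfolding f_def by (intro continuous_map_normalize_map cH' nzH' topspace_nsphere_nonzero)
  have "even (Brouwer_degree2 (Suc n) f - Brouwer_degree2 (Suc n - Suc 0) f)"
  proof (rule Borsuk_odd_mapping_degree_step [OF cf])
    fix u assume "u \<in> topspace (nsphere (Suc n))"
    have "H' (\<lambda>j. - u j) i = - H' u i" if "i \<le> Suc n" for i
      using hom_lipschitz_scale [OF H' [OF that], of "-1" u] by simp
    then show "(f \<circ> (\<lambda>x i. - x i)) u = ((\<lambda>x i. - x i) \<circ> f) u"
      by (auto simp: f_def normalize_map_def fun_eq_iff)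
  next
    show "f \<in> topspace (nsphere (Suc n - Suc 0)) \<rightarrow> topspace (nsphere (Suc n - Suc 0))"
    proof
      fix u assume u: "u \<in> topspace (nsphere (Suc n - Suc 0))"
      then have "u (Suc n) = 0" "u \<in> topspace (nsphere (Suc n))" by (auto simp: nsphere)
      then have "f u \<in> topspace (nsphere (Suc n))" "f u (Suc n) = 0"
        using continuous_map_image_subset_topspace [OF cf]
        by (auto simp: f_def normalize_map_def H'_def clamp0)
      then show "f u \<in> topspace (nsphere (Suc n - Suc 0))"
        using topspace_nsphere_minus1 by blast
    qed
  qed
  moreover have "Brouwer_degree2 n f = Brouwer_degree2 n (normalize_map n (\<lambda>x. H' (trunc x)))"
  proof (rule Brouwer_degree2_eq)
    fix x assume x: "x \<in> topspace (nsphere n)"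
    then have "trunc x = x" by (auto simp: nsphere trunc_def fun_eq_iff)
    moreover have "H' x (Suc n) = 0"
      using x by (simp add: nsphere H'_def clamp0)
    ultimately show "f x = normalize_map n (\<lambda>x. H' (trunc x)) x"
      by (intro ext) (auto simp: f_def normalize_map_def le_Suc_eq)
  qed
  moreover have "odd (Brouwer_degree2 n (normalize_map n (\<lambda>x. H' (trunc x))))"
  proof (rule Suc.IH)
    show "hom_lipschitz n (\<lambda>x. H' (trunc x) i)" if "i \<le> n" for i
      using trunc_lip [OF H'] that by simp
    show "\<exists>i\<le>n. H' (trunc x) i \<noteq> 0" if "\<exists>j\<le>n. x j \<noteq> 0" for x
    proof -
      have "H' (trunc x) (Suc n) = 0" by (simp add: H'_def clamp0 trunc_def)
      then show ?thesis
        using nzH' [OF trunc_nz [OF that]] by (metis le_Suc_eq)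
    qed
  qed
  ultimately show ?case by (simp add: deg)
qed

text \<open>Without a common zero, \<open>H\<close> padded with a last component 0 has no zero on
  the sphere. Its normalization then has odd degree; but it misses the pole \<open>e\<close>, so the
  degree is 0.\<close>

theorem Borsuk_Ulam_hom_lipschitz:
  fixes H :: "(nat \<Rightarrow> real) \<Rightarrow> nat \<Rightarrow> real"
  assumes "\<And>i. i < n \<Longrightarrow> hom_lipschitz n (\<lambda>x. H x i)"
  shows "\<exists>x. (\<exists>j\<le>n. x j \<noteq> 0) \<and> (\<forall>i<n. H x i = 0)"
proof (rule ccontr)
  assume *: "\<not> ?thesis"
  define K where "K x i = (if i < n then H x i else 0)" for x i
  have K: "hom_lipschitz n (\<lambda>x. K x i)" for i
    unfolding K_def using assms by (cases "i < n") (auto intro: hom_lipschitz_zero)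
  have nz: "\<exists>i\<le>n. K x i \<noteq> 0" if "\<exists>j\<le>n. x j \<noteq> 0" for x
    using * that by (auto simp: K_def intro: less_imp_le)
  have "odd (Brouwer_degree2 n (normalize_map n K))"
    using K nz by (rule odd_degree_normalize_map)
  moreover have "Brouwer_degree2 n (normalize_map n K) = 0"
  proof (rule Brouwer_degree2_nonsurjective)
    show "continuous_map (nsphere n) (nsphere n) (normalize_map n K)"
      by (intro continuous_map_normalize_map continuous_map_hom_lipschitz [OF K] nz topspace_nsphere_nonzero)
    define e where "e = (\<lambda>i. if i = n then 1 else 0 :: real)"
    have "e \<in> topspace (nsphere n)"
      by (simp add: nsphere e_def if_distrib [of "\<lambda>x. x\<^sup>2"] cong: if_cong)
    moreover have "normalize_map n K x n = 0" for x by (simp add: normalize_map_def K_def)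
    then have "e \<notin> normalize_map n K ` topspace (nsphere n)"
      by (metis (mono_tags, lifting) e_def image_iff zero_neq_one)
    ultimately show "normalize_map n K ` topspace (nsphere n) \<noteq> topspace (nsphere n)" by blast
  qed
  ultimately show False by simp
qed

section \<open>Polynomial functions of three variables\<close>

type_synonym point3 = "real \<times> real \<times> real"

text \<open>Here \<open>d\<close> is an upper bound for the total degree. Polynomials are treated as
  functions because the argument needs only sums, products, derivatives and restrictions to lines,
  all accessible by induction on this generation.\<close>

inductive polyfun :: "nat \<Rightarrow> (point3 \<Rightarrow> real) \<Rightarrow> bool" where
  const: "polyfun d (\<lambda>_. c)"
| add: "polyfun d f \<Longrightarrow> polyfun d g \<Longrightarrow> polyfun d (\<lambda>p. f p + g p)"
| mult_x: "polyfun d f \<Longrightarrow> polyfun (Suc d) (\<lambda>p. fst p * f p)"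
| mult_y: "polyfun d f \<Longrightarrow> polyfun (Suc d) (\<lambda>p. fst (snd p) * f p)"
| mult_z: "polyfun d f \<Longrightarrow> polyfun (Suc d) (\<lambda>p. snd (snd p) * f p)"

lemma polyfun_mono: "polyfun d f \<Longrightarrow> d \<le> e \<Longrightarrow> polyfun e f"
proof (induction arbitrary: e rule: polyfun.induct)
  case (mult_x d f)
  then show ?case by (cases e) (auto intro: polyfun.mult_x)
next
  case (mult_y d f)
  then show ?case by (cases e) (auto intro: polyfun.mult_y)
next
  case (mult_z d f)
  then show ?case by (cases e) (auto intro: polyfun.mult_z)
qed (auto intro: polyfun.intros)

lemma polyfun_cmult: "polyfun d f \<Longrightarrow> polyfun d (\<lambda>p. c * f p)"
proof (induction rule: polyfun.induct)
  case (const d a)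
  show ?case by (rule polyfun.const)
next
  case (add d f g)
  then show ?case by (simp add: distrib_left polyfun.add)
next
  case (mult_x d f)
  show ?case using polyfun.mult_x [OF mult_x.IH] by (simp add: mult.left_commute)
next
  case (mult_y d f)
  show ?case using polyfun.mult_y [OF mult_y.IH] by (simp add: mult.left_commute)
next
  case (mult_z d f)
  show ?case using polyfun.mult_z [OF mult_z.IH] by (simp add: mult.left_commute)
qed

lemma polyfun_mult: "polyfun d f \<Longrightarrow> polyfun e g \<Longrightarrow> polyfun (d + e) (\<lambda>p. f p * g p)"
proof (induction rule: polyfun.induct)
  case (const d a)
  then show ?case using polyfun_cmult polyfun_mono le_add2 by blast
next
  case (add d f h)
  then show ?case by (simp add: distrib_right polyfun.add)
next
  case (mult_x d f)
  show ?case using polyfun.mult_x [OF mult_x.IH [OF mult_x.prems]] by (simp add: mult.assoc)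
next
  case (mult_y d f)
  show ?case using polyfun.mult_y [OF mult_y.IH [OF mult_y.prems]] by (simp add: mult.assoc)
next
  case (mult_z d f)
  show ?case using polyfun.mult_z [OF mult_z.IH [OF mult_z.prems]] by (simp add: mult.assoc)
qed

lemma polyfun_diff: "polyfun d f \<Longrightarrow> polyfun d g \<Longrightarrow> polyfun d (\<lambda>p. f p - g p)"
  using polyfun.add [OF _ polyfun_cmult [of d g "-1"]] by simp

lemma polyfun_sum: "(\<And>i. i \<in> I \<Longrightarrow> polyfun d (f i)) \<Longrightarrow> polyfun d (\<lambda>p. \<Sum>i\<in>I. f i p)"
  by (induction I rule: infinite_finite_induct) (auto intro: polyfun.const polyfun.add)

lemma polyfun_prod:
  "finite I \<Longrightarrow> (\<And>i. i \<in> I \<Longrightarrow> polyfun (d i) (f i)) \<Longrightarrow> polyfun (\<Sum>i\<in>I. d i) (\<lambda>p. \<Prod>i\<in>I. f i p)"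
  by (induction I rule: finite_induct) (auto intro: polyfun.const polyfun_mult)

lemma polyfun_monomial: "polyfun (i + j + k) (\<lambda>p. fst p ^ i * fst (snd p) ^ j * snd (snd p) ^ k)"
proof -
  have *: "polyfun n (\<lambda>p. h p ^ n)" if "polyfun 1 h" for h n
  proof (induction n)
    case 0
    show ?case by (simp add: polyfun.const)
  next
    case (Suc n)
    then show ?case using polyfun_mult [OF that Suc] by simp
  qed
  have "polyfun 1 fst" "polyfun 1 (\<lambda>p. fst (snd p))" "polyfun 1 (\<lambda>p. snd (snd p))"
    using polyfun.mult_x [OF polyfun.const [of 0 1]] polyfun.mult_y [OF polyfun.const [of 0 1]]
      polyfun.mult_z [OF polyfun.const [of 0 1]] by simp_all
  then show ?thesis by (intro polyfun_mult *)
qed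

lemma polyfun_restrict_line:
  assumes "polyfun d f"
  obtains P :: "real poly" where "degree P \<le> d" "\<And>t. f (x + t * a, y + t * b, z + t * c) = poly P t"
proof -
  have lin: "degree (pCons u (pCons v 0) * P) \<le> Suc n" if "degree P \<le> n" for u v :: real and P n
    using degree_mult_le [of "[:u, v:]" P] degree_pCons_le [of u "[:v:]"] that
    by (simp add: degree_pCons_eq_if split: if_splits)
  have "\<exists>P. degree P \<le> d \<and> (\<forall>t. f (x + t * a, y + t * b, z + t * c) = poly P t)"
    using assms
  proof (induction rule: polyfun.induct)
    case (const d u)
    show ?case by (rule exI [of _ "[:u:]"]) simp
  next
    case (add d f g)
    then obtain P Q where "degree P \<le> d" "\<forall>t. f (x + t * a, y + t * b, z + t * c) = poly P t"
      "degree Q \<le> d" "\<forall>t. g (x + t * a, y + t * b, z + t * c) = poly Q t" by blast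
    then show ?case by (intro exI [of _ "P + Q"]) (auto intro: degree_add_le)
  next
    case (mult_x d f)
    then obtain P where P: "degree P \<le> d" "\<forall>t. f (x + t * a, y + t * b, z + t * c) = poly P t" by blast
    show ?case
      by (intro exI [of _ "[:x, a:] * P"] conjI lin P) (simp add: P algebra_simps)
  next
    case (mult_y d f)
    then obtain P where P: "degree P \<le> d" "\<forall>t. f (x + t * a, y + t * b, z + t * c) = poly P t" by blast
    show ?case
      by (intro exI [of _ "[:y, b:] * P"] conjI lin P) (simp add: P algebra_simps)
  next
    case (mult_z d f)
    then obtain P where P: "degree P \<le> d" "\<forall>t. f (x + t * a, y + t * b, z + t * c) = poly P t" by blast
    show ?case
      by (intro exI [of _ "[:z, c:] * P"] conjI lin P) (simp add: P algebra_simps)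
  qed
  then show thesis using that by blast
qed

lemma polyfun_vanishes_on_line:
  assumes f: "polyfun d f" and S: "card S > d"
    and z: "\<And>p. p \<in> S \<Longrightarrow> f p = 0 \<and> (\<exists>t. p = (x + t * a, y + t * b, z + t * c))"
  shows "f (x + t * a, y + t * b, z + t * c) = 0"
proof -
  obtain P where P: "degree P \<le> d" "\<And>t. f (x + t * a, y + t * b, z + t * c) = poly P t"
    using polyfun_restrict_line [OF f] by metis
  have "P = 0"
  proof (rule ccontr)
    assume "P \<noteq> 0"
    have fin: "finite {t. poly P t = 0}" using \<open>P \<noteq> 0\<close> by (rule poly_roots_finite)
    have "S \<subseteq> (\<lambda>t. (x + t * a, y + t * b, z + t * c)) ` {t. poly P t = 0}"
    proof
      fix p assume "p \<in> S"
      then obtain t where t: "p = (x + t * a, y + t * b, z + t * c)" and "f p = 0" using z by blast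
      then have "poly P t = 0" using P(2) by simp
      then show "p \<in> (\<lambda>t. (x + t * a, y + t * b, z + t * c)) ` {t. poly P t = 0}"
        unfolding t by (intro imageI) simp
    qed
    then have "card S \<le> card {t. poly P t = 0}"
      by (rule surj_card_le [OF fin])
    also have "\<dots> \<le> d" using card_poly_roots_bound [OF \<open>P \<noteq> 0\<close>] P(1) by linarith
    finally show False using S by simp
  qed
  then show ?thesis using P by simp
qed

text \<open>On the line joining \<open>p\<close> and \<open>q\<close> both functions restrict to
  nonzero polynomials in one variable, and these have no zero divisors.\<close>

lemma polyfun_mult_nonzero:
  assumes "polyfun d f" "polyfun e g" "f p \<noteq> 0" "g q \<noteq> 0"
  shows "\<exists>r. f r * g r \<noteq> 0"
proof -
  obtain x y z where p: "p = (x, y, z)" by (metis prod_cases3)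
  obtain x' y' z' where q: "q = (x', y', z')" by (metis prod_cases3)
  let ?l = "\<lambda>t. (x + t * (x' - x), y + t * (y' - y), z + t * (z' - z))"
  obtain P where P: "\<And>t. f (?l t) = poly P t"
    using polyfun_restrict_line [OF assms(1)] by metis
  obtain Q where Q: "\<And>t. g (?l t) = poly Q t"
    using polyfun_restrict_line [OF assms(2)] by metis
  have "P \<noteq> 0" using P [of 0] assms(3) p by auto
  moreover have "Q \<noteq> 0" using Q [of 1] assms(4) q by auto
  ultimately have "P * Q \<noteq> 0" by simp
  then obtain t where "poly (P * Q) t \<noteq> 0" using poly_all_0_iff_0 by blast
  then show ?thesis using P Q by (intro exI [of _ "?l t"]) simp
qed

lemma polyfun_prod_nonzero:
  assumes "finite I" "\<And>i. i \<in> I \<Longrightarrow> polyfun (d i) (f i)" "\<And>i. i \<in> I \<Longrightarrow> \<exists>p. f i p \<noteq> 0"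
  shows "\<exists>p. (\<Prod>i\<in>I. f i p) \<noteq> 0"
  using assms
proof (induction I rule: finite_induct)
  case (insert i I)
  obtain p where p: "f i p \<noteq> 0" using insert.prems(2) by blast
  obtain q where q: "(\<Prod>i\<in>I. f i q) \<noteq> 0" using insert.IH insert.prems by blast
  have fi: "polyfun (d i) (f i)" using insert.prems(1) by blast
  have "polyfun (\<Sum>i\<in>I. d i) (\<lambda>p. \<Prod>i\<in>I. f i p)"
    using insert by (intro polyfun_prod) auto
  from polyfun_mult_nonzero [OF fi this p q] show ?case
    by (simp only: prod.insert [OF insert.hyps])
qed auto

text \<open>Only derivatives along lines are recorded; \<open>has_hessian\<close> uses the same functions for both orders
  of the mixed derivatives.\<close>

definition has_grad :: "(point3 \<Rightarrow> real) \<Rightarrow> (point3 \<Rightarrow> real) \<Rightarrow> (point3 \<Rightarrow> real) \<Rightarrow> (point3 \<Rightarrow> real) \<Rightarrow> bool" where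
  "has_grad f fx fy fz \<longleftrightarrow>
     (\<forall>x y z a b c s. ((\<lambda>t. f (x + t * a, y + t * b, z + t * c)) has_real_derivative
        (let p = (x + s * a, y + s * b, z + s * c) in a * fx p + b * fy p + c * fz p)) (at s))"

lemma has_gradD:
  assumes "has_grad f fx fy fz"
  shows "((\<lambda>t. f (x + t * a, y + t * b, z + t * c)) has_real_derivative
           a * fx (x + s * a, y + s * b, z + s * c) + b * fy (x + s * a, y + s * b, z + s * c)
           + c * fz (x + s * a, y + s * b, z + s * c)) (at s)"
  using assms by (simp add: has_grad_def Let_def)

lemma has_grad_const: "has_grad (\<lambda>_. u) (\<lambda>_. 0) (\<lambda>_. 0) (\<lambda>_. 0)"
  by (simp add: has_grad_def)

lemma has_grad_add:
  assumes "has_grad f fx fy fz" "has_grad g gx gy gz"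
  shows "has_grad (\<lambda>p. f p + g p) (\<lambda>p. fx p + gx p) (\<lambda>p. fy p + gy p) (\<lambda>p. fz p + gz p)"
  unfolding has_grad_def Let_def
  by (intro allI, rule DERIV_cong [OF DERIV_add [OF has_gradD [OF assms(1)] has_gradD [OF assms(2)]]])
    (simp add: algebra_simps)

lemma has_grad_mult_x:
  assumes "has_grad f fx fy fz"
  shows "has_grad (\<lambda>p. fst p * f p) (\<lambda>p. fst p * fx p + f p) (\<lambda>p. fst p * fy p) (\<lambda>p. fst p * fz p)"
  unfolding has_grad_def Let_def
  by (intro allI, rule DERIV_cong [OF DERIV_mult [OF _ has_gradD [OF assms]]], simp,
      (rule derivative_intros)+, simp add: algebra_simps)

lemma has_grad_mult_y:
  assumes "has_grad f fx fy fz"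
  shows "has_grad (\<lambda>p. fst (snd p) * f p) (\<lambda>p. fst (snd p) * fx p) (\<lambda>p. fst (snd p) * fy p + f p) (\<lambda>p. fst (snd p) * fz p)"
  unfolding has_grad_def Let_def
  by (intro allI, rule DERIV_cong [OF DERIV_mult [OF _ has_gradD [OF assms]]], simp,
      (rule derivative_intros)+, simp add: algebra_simps)

lemma has_grad_mult_z:
  assumes "has_grad f fx fy fz"
  shows "has_grad (\<lambda>p. snd (snd p) * f p) (\<lambda>p. snd (snd p) * fx p) (\<lambda>p. snd (snd p) * fy p) (\<lambda>p. snd (snd p) * fz p + f p)"
  unfolding has_grad_def Let_def
  by (intro allI, rule DERIV_cong [OF DERIV_mult [OF _ has_gradD [OF assms]]], simp,
      (rule derivative_intros)+, simp add: algebra_simps)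

definition has_hessian where
  "has_hessian f fx fy fz fxx fxy fxz fyy fyz fzz \<longleftrightarrow>
     has_grad f fx fy fz \<and> has_grad fx fxx fxy fxz \<and> has_grad fy fxy fyy fyz \<and> has_grad fz fxz fyz fzz"

text \<open>The clause for \<open>d = 0\<close> compensates for the truncated subtraction
  \<open>0 - 1 = 0\<close>: in the multiplication cases a coordinate times a first derivative must
  again have degree at most \<open>d\<close>, and for \<open>d = 0\<close> this holds only because
  the derivative is 0.\<close>

lemma polyfun_has_hessian:
  assumes "polyfun d f"
  shows "\<exists>fx fy fz fxx fxy fxz fyy fyz fzz. has_hessian f fx fy fz fxx fxy fxz fyy fyz fzz \<and>
           polyfun (d - 1) fx \<and> polyfun (d - 1) fy \<and> polyfun (d - 1) fz \<and>
           (d = 0 \<longrightarrow> (\<forall>p. fx p = 0 \<and> fy p = 0 \<and> fz p = 0))"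
  using assms
proof (induction rule: polyfun.induct)
  case (const d u)
  show ?case
    unfolding has_hessian_def using has_grad_const polyfun.const by blast
next
  case (add d f g)
  obtain fx fy fz fxx fxy fxz fyy fyz fzz where
    f: "has_hessian f fx fy fz fxx fxy fxz fyy fyz fzz"
       "polyfun (d - 1) fx" "polyfun (d - 1) fy" "polyfun (d - 1) fz"
       "d = 0 \<longrightarrow> (\<forall>p. fx p = 0 \<and> fy p = 0 \<and> fz p = 0)"
    using add.IH(1) by blast
  obtain gx gy gz gxx gxy gxz gyy gyz gzz where
    g: "has_hessian g gx gy gz gxx gxy gxz gyy gyz gzz"
       "polyfun (d - 1) gx" "polyfun (d - 1) gy" "polyfun (d - 1) gz"
       "d = 0 \<longrightarrow> (\<forall>p. gx p = 0 \<and> gy p = 0 \<and> gz p = 0)"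
    using add.IH(2) by blast
  have "has_hessian (\<lambda>p. f p + g p) (\<lambda>p. fx p + gx p) (\<lambda>p. fy p + gy p) (\<lambda>p. fz p + gz p)
     (\<lambda>p. fxx p + gxx p) (\<lambda>p. fxy p + gxy p) (\<lambda>p. fxz p + gxz p) (\<lambda>p. fyy p + gyy p)
     (\<lambda>p. fyz p + gyz p) (\<lambda>p. fzz p + gzz p)"
    using f(1) g(1) by (auto simp: has_hessian_def intro: has_grad_add)
  moreover have "polyfun (d - 1) (\<lambda>p. fx p + gx p)" "polyfun (d - 1) (\<lambda>p. fy p + gy p)"
    "polyfun (d - 1) (\<lambda>p. fz p + gz p)"
    using f g by (auto intro: polyfun.add)
  moreover have "d = 0 \<longrightarrow> (\<forall>p. fx p + gx p = 0 \<and> fy p + gy p = 0 \<and> fz p + gz p = 0)"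
    using f(5) g(5) by simp
  ultimately show ?case by blast
next
  case (mult_x d f)
  obtain fx fy fz fxx fxy fxz fyy fyz fzz where
    f: "has_hessian f fx fy fz fxx fxy fxz fyy fyz fzz"
       "polyfun (d - 1) fx" "polyfun (d - 1) fy" "polyfun (d - 1) fz"
       "d = 0 \<longrightarrow> (\<forall>p. fx p = 0 \<and> fy p = 0 \<and> fz p = 0)"
    using mult_x.IH by blast
  have "has_hessian (\<lambda>p. fst p * f p) (\<lambda>p. fst p * fx p + f p) (\<lambda>p. fst p * fy p) (\<lambda>p. fst p * fz p)
     (\<lambda>p. fst p * fxx p + fx p + fx p) (\<lambda>p. fst p * fxy p + fy p) (\<lambda>p. fst p * fxz p + fz p) (\<lambda>p. fst p * fyy p) (\<lambda>p. fst p * fyz p) (\<lambda>p. fst p * fzz p)"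
    using f(1) unfolding has_hessian_def
    by (intro conjI has_grad_mult_x has_grad_add) auto
  moreover have m: "polyfun d (\<lambda>p. fst p * h p)" if "polyfun (d - 1) h" "d = 0 \<longrightarrow> (\<forall>p. h p = 0)" for h
  proof (cases d)
    case 0
    then have "h = (\<lambda>_. 0)" using that(2) by (intro ext) blast
    then show ?thesis using polyfun.const [of d 0] by simp
  next
    case (Suc n)
    then show ?thesis using that(1) polyfun.mult_x [of n h] by simp
  qed
  have 1: "polyfun d (\<lambda>p. fst p * fx p)" "polyfun d (\<lambda>p. fst p * fy p)" "polyfun d (\<lambda>p. fst p * fz p)"
    using m [OF f(2)] m [OF f(3)] m [OF f(4)] f(5) by blast+
  moreover have "polyfun d (\<lambda>p. fst p * fx p + f p)"
    using 1 mult_x.hyps by (intro polyfun.add)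
  ultimately show ?case by (intro exI conjI) (assumption | simp)+
next
  case (mult_y d f)
  obtain fx fy fz fxx fxy fxz fyy fyz fzz where
    f: "has_hessian f fx fy fz fxx fxy fxz fyy fyz fzz"
       "polyfun (d - 1) fx" "polyfun (d - 1) fy" "polyfun (d - 1) fz"
       "d = 0 \<longrightarrow> (\<forall>p. fx p = 0 \<and> fy p = 0 \<and> fz p = 0)"
    using mult_y.IH by blast
  have "has_hessian (\<lambda>p. fst (snd p) * f p) (\<lambda>p. fst (snd p) * fx p) (\<lambda>p. fst (snd p) * fy p + f p) (\<lambda>p. fst (snd p) * fz p)
     (\<lambda>p. fst (snd p) * fxx p) (\<lambda>p. fst (snd p) * fxy p + fx p) (\<lambda>p. fst (snd p) * fxz p) (\<lambda>p. fst (snd p) * fyy p + fy p + fy p) (\<lambda>p. fst (snd p) * fyz p + fz p) (\<lambda>p. fst (snd p) * fzz p)"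
    using f(1) unfolding has_hessian_def
    by (intro conjI has_grad_mult_y has_grad_add) auto
  moreover have m: "polyfun d (\<lambda>p. fst (snd p) * h p)" if "polyfun (d - 1) h" "d = 0 \<longrightarrow> (\<forall>p. h p = 0)" for h
  proof (cases d)
    case 0
    then have "h = (\<lambda>_. 0)" using that(2) by (intro ext) blast
    then show ?thesis using polyfun.const [of d 0] by simp
  next
    case (Suc n)
    then show ?thesis using that(1) polyfun.mult_y [of n h] by simp
  qed
  have 1: "polyfun d (\<lambda>p. fst (snd p) * fx p)" "polyfun d (\<lambda>p. fst (snd p) * fy p)" "polyfun d (\<lambda>p. fst (snd p) * fz p)"
    using m [OF f(2)] m [OF f(3)] m [OF f(4)] f(5) by blast+
  moreover have "polyfun d (\<lambda>p. fst (snd p) * fy p + f p)"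
    using 1 mult_y.hyps by (intro polyfun.add)
  ultimately show ?case by (intro exI conjI) (assumption | simp)+
next
  case (mult_z d f)
  obtain fx fy fz fxx fxy fxz fyy fyz fzz where
    f: "has_hessian f fx fy fz fxx fxy fxz fyy fyz fzz"
       "polyfun (d - 1) fx" "polyfun (d - 1) fy" "polyfun (d - 1) fz"
       "d = 0 \<longrightarrow> (\<forall>p. fx p = 0 \<and> fy p = 0 \<and> fz p = 0)"
    using mult_z.IH by blast
  have "has_hessian (\<lambda>p. snd (snd p) * f p) (\<lambda>p. snd (snd p) * fx p) (\<lambda>p. snd (snd p) * fy p) (\<lambda>p. snd (snd p) * fz p + f p)
     (\<lambda>p. snd (snd p) * fxx p) (\<lambda>p. snd (snd p) * fxy p) (\<lambda>p. snd (snd p) * fxz p + fx p) (\<lambda>p. snd (snd p) * fyy p) (\<lambda>p. snd (snd p) * fyz p + fy p) (\<lambda>p. snd (snd p) * fzz p + fz p + fz p)"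
    using f(1) unfolding has_hessian_def
    by (intro conjI has_grad_mult_z has_grad_add) auto
  moreover have m: "polyfun d (\<lambda>p. snd (snd p) * h p)" if "polyfun (d - 1) h" "d = 0 \<longrightarrow> (\<forall>p. h p = 0)" for h
  proof (cases d)
    case 0
    then have "h = (\<lambda>_. 0)" using that(2) by (intro ext) blast
    then show ?thesis using polyfun.const [of d 0] by simp
  next
    case (Suc n)
    then show ?thesis using that(1) polyfun.mult_z [of n h] by simp
  qed
  have 1: "polyfun d (\<lambda>p. snd (snd p) * fx p)" "polyfun d (\<lambda>p. snd (snd p) * fy p)" "polyfun d (\<lambda>p. snd (snd p) * fz p)"
    using m [OF f(2)] m [OF f(3)] m [OF f(4)] f(5) by blast+
  moreover have "polyfun d (\<lambda>p. snd (snd p) * fz p + f p)"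
    using 1 mult_z.hyps by (intro polyfun.add)
  ultimately show ?case by (intro exI conjI) (assumption | simp)+
qed

section \<open>Lines on an algebraic surface\<close>

lemma has_grad_vanishing_line:
  assumes "has_grad f fx fy fz" "\<And>t. f (x + t * a, y + t * b, z + t * c) = 0"
  shows "a * fx (x + s * a, y + s * b, z + s * c) + b * fy (x + s * a, y + s * b, z + s * c)
           + c * fz (x + s * a, y + s * b, z + s * c) = 0"
proof (rule DERIV_unique)
  show "((\<lambda>t. f (x + t * a, y + t * b, z + t * c)) has_real_derivative
           a * fx (x + s * a, y + s * b, z + s * c) + b * fy (x + s * a, y + s * b, z + s * c)
           + c * fz (x + s * a, y + s * b, z + s * c)) (at s)"
    by (rule has_gradD [OF assms(1)])
  show "((\<lambda>t. f (x + t * a, y + t * b, z + t * c)) has_real_derivative 0) (at s)"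
    using assms(2) by simp
qed

lemma has_grad_zero_imp_const:
  assumes "has_grad f fx fy fz" "\<And>p. fx p = 0 \<and> fy p = 0 \<and> fz p = 0"
  shows "f p = f q"
proof -
  have "f (x, y, z) = f (0, 0, 0)" for x y z
  proof -
    have "\<forall>t. ((\<lambda>t. f (0 + t * x, 0 + t * y, 0 + t * z)) has_real_derivative 0) (at t)"
    proof
      fix s
      show "((\<lambda>t. f (0 + t * x, 0 + t * y, 0 + t * z)) has_real_derivative 0) (at s)"
        by (rule DERIV_cong [OF has_gradD [OF assms(1)]]) (simp only: assms(2) mult_zero_right add_0_right)
    qed
    from DERIV_isconst_all [OF this, of 1 0] show ?thesis by simp
  qed
  then show ?thesis by (metis prod_cases3)
qed

section \<open>Polynomials of least degree and the peeling of lines\<close>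

text \<open>The replacement for a square-free polynomial: every first derivative that vanishes on
  \<open>U\<close> has smaller degree and is therefore identically zero. For nonempty
  \<open>U\<close> this cannot happen to all three, since \<open>g\<close> would be constant, hence
  0.\<close>

definition minimal_vanishing :: "nat \<Rightarrow> (point3 \<Rightarrow> real) \<Rightarrow> point3 set \<Rightarrow> bool" where
  "minimal_vanishing d g U \<longleftrightarrow> polyfun d g \<and> (\<exists>p. g p \<noteq> 0) \<and> (\<forall>p\<in>U. g p = 0) \<and>
     (\<forall>e h. e < d \<and> polyfun e h \<and> (\<forall>p\<in>U. h p = 0) \<longrightarrow> (\<forall>p. h p = 0))"

lemma minimal_vanishing_exists:
  assumes "polyfun d f" "f q \<noteq> 0" "\<And>p. p \<in> U \<Longrightarrow> f p = 0"
  obtains e g where "e \<le> d" "minimal_vanishing e g U"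
proof -
  define A where "A e \<longleftrightarrow> (\<exists>g. polyfun e g \<and> (\<exists>p. g p \<noteq> 0) \<and> (\<forall>p\<in>U. g p = 0))" for e
  have "A d" unfolding A_def using assms by blast
  define e where "e = (LEAST e. A e)"
  have "A e" unfolding e_def using \<open>A d\<close> by (rule LeastI)
  then obtain g where "polyfun e g" "\<exists>p. g p \<noteq> 0" "\<forall>p\<in>U. g p = 0" unfolding A_def by blast
  moreover have "\<not> A e'" if "e' < e" for e' using that unfolding e_def by (rule not_less_Least)
  ultimately have "minimal_vanishing e g U" unfolding minimal_vanishing_def A_def by blast
  moreover have "e \<le> d" unfolding e_def using \<open>A d\<close> by (rule Least_le)
  ultimately show thesis using that by blast
qed

lemma minimal_vanishing_hessian:
  assumes "minimal_vanishing d g U" "U \<noteq> {}"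
  obtains gx gy gz gxx gxy gxz gyy gyz gzz where
    "has_hessian g gx gy gz gxx gxy gxz gyy gyz gzz" "d > 0"
    "polyfun (d - 1) gx" "polyfun (d - 1) gy" "polyfun (d - 1) gz"
    "\<not> ((\<forall>p. gx p = 0) \<and> (\<forall>p. gy p = 0) \<and> (\<forall>p. gz p = 0))"
proof -
  have g: "polyfun d g" "\<exists>p. g p \<noteq> 0" "\<forall>p\<in>U. g p = 0"
    using assms(1) unfolding minimal_vanishing_def by auto
  obtain gx gy gz gxx gxy gxz gyy gyz gzz where
    h: "has_hessian g gx gy gz gxx gxy gxz gyy gyz gzz"
       "polyfun (d - 1) gx" "polyfun (d - 1) gy" "polyfun (d - 1) gz"
       "d = 0 \<longrightarrow> (\<forall>p. gx p = 0 \<and> gy p = 0 \<and> gz p = 0)"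
    using polyfun_has_hessian [OF g(1)] by blast
  have nz: "\<not> ((\<forall>p. gx p = 0) \<and> (\<forall>p. gy p = 0) \<and> (\<forall>p. gz p = 0))"
  proof
    assume "(\<forall>p. gx p = 0) \<and> (\<forall>p. gy p = 0) \<and> (\<forall>p. gz p = 0)"
    then have z: "\<And>p. gx p = 0 \<and> gy p = 0 \<and> gz p = 0" by blast
    have "has_grad g gx gy gz" using h(1) by (simp add: has_hessian_def)
    from has_grad_zero_imp_const [OF this z] g(2,3) assms(2) show False
      by (metis ex_in_conv)
  qed
  moreover have "d > 0" using h(5) nz by blast
  ultimately show thesis using that h by blast
qed

lemma minimal_vanishing_lower:
  assumes "minimal_vanishing d g U" "d > 0" "polyfun (d - 1) h" "\<And>p. p \<in> U \<Longrightarrow> h p = 0"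
  shows "h p = 0"
  using assms unfolding minimal_vanishing_def by (metis diff_less zero_less_one)

text \<open>The potential is the sum over \<open>p\<close> of the excess of its degree over
  \<open>k\<close>. Deleting the element supplied by \<open>peel\<close> lowers the excess by at
  most 1 at each of at most \<open>D\<close> points and leaves it alone elsewhere, so the initial
  potential is at most \<open>D * card M\<close>; adding \<open>k\<close> per point recovers the
  full count. The relation is generic because \<open>M\<close> consists of directed points on the
  dual side and of circles on the primal side.\<close>

lemma incidence_peeling:
  assumes fin: "finite M" "finite N"
    and peel: "\<And>M'. M' \<subseteq> M \<Longrightarrow> M' \<noteq> {} \<Longrightarrow>
                 \<exists>l\<in>M'. card {p\<in>N. R l p \<and> card {l'\<in>M'. R l' p} > k} \<le> D"
  shows "card {(l, p). l \<in> M \<and> p \<in> N \<and> R l p} \<le> D * card M + k * card N"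
proof -
  define deg where "deg M' p = card {l\<in>M'. R l p}" for M' p
  have claim: "M' \<subseteq> M \<Longrightarrow> (\<Sum>p\<in>N. deg M' p - k) \<le> D * card M'" for M'
  proof (induction "card M'" arbitrary: M')
    case 0
    then have "M' = {}" using fin(1) finite_subset by fastforce
    then show ?case by (simp add: deg_def)
  next
    case (Suc c)
    have finM': "finite M'" using Suc.prems fin(1) finite_subset by blast
    have "M' \<noteq> {}" using Suc.hyps(2) by auto
    then obtain l where l: "l \<in> M'" "card {p\<in>N. R l p \<and> deg M' p > k} \<le> D"
      using peel [OF Suc.prems] unfolding deg_def by blast
    have c: "card (M' - {l}) = c" using Suc.hyps(2) l(1) finM' by simp
    have IH: "(\<Sum>p\<in>N. deg (M' - {l}) p - k) \<le> D * c"
      using Suc.hyps(1) [of "M' - {l}"] Suc.prems c by auto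
    \<comment> \<open>Truncated subtraction matters here: at a point of degree at most
      \<open>k\<close> the deletion costs nothing.\<close>
    have step: "deg M' p - k \<le> (deg (M' - {l}) p - k) + (if R l p \<and> deg M' p > k then 1 else 0)" for p
    proof (cases "R l p")
      case True
      then have "{l'\<in>M'. R l' p} = insert l {l'\<in>M' - {l}. R l' p}" using l(1) by auto
      then have "deg M' p = Suc (deg (M' - {l}) p)" using finM' by (simp add: deg_def)
      then show ?thesis using True by (simp, arith)
    next
      case False
      then have "{l'\<in>M'. R l' p} = {l'\<in>M' - {l}. R l' p}" by auto
      then show ?thesis by (simp add: deg_def)
    qed
    have "(\<Sum>p\<in>N. deg M' p - k) \<le>
        (\<Sum>p\<in>N. (deg (M' - {l}) p - k) + (if R l p \<and> deg M' p > k then 1 else 0))"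
      by (rule sum_mono) (rule step)
    also have "\<dots> = (\<Sum>p\<in>N. deg (M' - {l}) p - k) + card {p\<in>N. R l p \<and> deg M' p > k}"
      using fin(2) by (simp add: sum.distrib sum.If_cases Int_def)
    also have "\<dots> \<le> D * c + D" using IH l(2) by linarith
    finally show ?case using Suc.hyps(2) by (simp flip: Suc.hyps(2) add: algebra_simps)
  qed
  have "{(l, p). l \<in> M \<and> p \<in> N \<and> R l p} = (\<lambda>(p, l). (l, p)) ` (SIGMA p:N. {l\<in>M. R l p})"
    by (auto simp: image_iff)
  then have "card {(l, p). l \<in> M \<and> p \<in> N \<and> R l p} = card (SIGMA p:N. {l\<in>M. R l p})"
    by (simp add: card_image inj_on_def split_beta prod_eq_iff)
  also have "\<dots> = (\<Sum>p\<in>N. deg M p)" using fin by (simp add: deg_def)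
  also have "\<dots> \<le> (\<Sum>p\<in>N. (deg M p - k) + k)" by (rule sum_mono) simp
  also have "\<dots> = (\<Sum>p\<in>N. deg M p - k) + k * card N" by (simp add: sum.distrib)
  also have "\<dots> \<le> D * card M + k * card N" using claim [of M] by simp
  finally show ?thesis .
qed

section \<open>The two families of lines\<close>

text \<open>Fixing the first argument leaves a line of circles with direction
  \<open>(-t^2, t, 1)\<close>, null for the Lorentz form \<open>A C + B^2 = a^2 + b^2 - s^2\<close>;
  fixing the second leaves a line with direction \<open>(1, -C, B)\<close>. The parametrizations
  below keep the terms \<open>0\<close> and \<open>s * 1\<close> to match the shape of lines in the
  restriction lemmas.\<close>

fun on_line :: "point3 \<Rightarrow> point3 \<Rightarrow> bool" where
  "on_line (t, q, w) (A, B, C) \<longleftrightarrow> q = B - C * t \<and> w = A + B * t"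

lemma on_line_iff_light: "on_line (t, q, w) l \<longleftrightarrow> (\<exists>s. l = (w - q * t + s * (- t\<^sup>2), q + s * t, 0 + s * 1))"
  by (cases l) (auto simp: algebra_simps power2_eq_square)

lemma on_line_iff_contact: "on_line p (A, B, C) \<longleftrightarrow> (\<exists>s. p = (0 + s * 1, B + s * (- C), A + s * B))"
  by (cases p) (auto simp: algebra_simps)

lemma quadratic_three_roots:
  fixes a b c :: real
  assumes "a * t1\<^sup>2 + b * t1 + c = 0" "a * t2\<^sup>2 + b * t2 + c = 0" "a * t3\<^sup>2 + b * t3 + c = 0"
    "t1 \<noteq> t2" "t1 \<noteq> t3" "t2 \<noteq> t3"
  shows "a = 0 \<and> b = 0 \<and> c = 0"
proof -
  have "(t1 - t2) * (a * (t1 + t2) + b) = 0"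
    using assms(1,2) by (simp add: algebra_simps power2_eq_square)
  then have 1: "a * (t1 + t2) + b = 0" using assms(4) by simp
  have "(t1 - t3) * (a * (t1 + t3) + b) = 0"
    using assms(1,3) by (simp add: algebra_simps power2_eq_square)
  then have 2: "a * (t1 + t3) + b = 0" using assms(5) by simp
  have "a * (t2 - t3) = (a * (t1 + t2) + b) - (a * (t1 + t3) + b)" by (simp add: algebra_simps)
  then have "a * (t2 - t3) = 0" using 1 2 by simp
  then have "a = 0" using assms(6) by simp
  then show ?thesis using 1 assms(1) by simp
qed

lemma linear_two_roots:
  fixes u v c c' :: real
  assumes "u - c * v = 0" "u - c' * v = 0" "c \<noteq> c'"
  shows "u = 0 \<and> v = 0"
  using assms by auto

lemma obtain_two:
  assumes "card S > 1"
  obtains a b where "a \<in> S" "b \<in> S" "a \<noteq> b"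
proof -
  obtain T where T: "T \<subseteq> S" "card T = 2"
    by (metis assms Suc_leI one_add_one plus_1_eq_Suc obtain_subset_with_card_n)
  then obtain a b where "T = {a, b}" "a \<noteq> b"
    by (auto simp: card_2_iff)
  then show thesis using T(1) that by auto
qed

lemma obtain_three:
  assumes "card S > 2"
  obtains a b c where "a \<in> S" "b \<in> S" "c \<in> S" "a \<noteq> b" "a \<noteq> c" "b \<noteq> c"
proof -
  obtain T where T: "T \<subseteq> S" "card T = 3"
    by (metis assms Suc_leI eval_nat_numeral(3) obtain_subset_with_card_n)
  then obtain a b c where "T = {a, b, c}" "a \<noteq> b" "a \<noteq> c" "b \<noteq> c"
    by (auto simp: card_3_iff)
  then show thesis using T(1) that by auto
qed

text \<open>Three concurrent light lines have linearly independent directions (they lie on a cone), so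
  the gradient of a function vanishing on them vanishes at the common point.\<close>

lemma exists_light_line_few_triple_points:
  assumes M: "M \<noteq> {}" and f: "polyfun d f" "f r \<noteq> 0" "\<And>p l. p \<in> M \<Longrightarrow> on_line p l \<Longrightarrow> f l = 0"
  shows "\<exists>p\<in>M. card {l\<in>N. on_line p l \<and> card {p'\<in>M. on_line p' l} > 2} \<le> d"
proof (rule ccontr)
  assume "\<not> ?thesis"
  then have rich: "card {l\<in>N. on_line p l \<and> card {p'\<in>M. on_line p' l} > 2} > d" if "p \<in> M" for p
    using that by force
  define U where "U = {l. \<exists>p\<in>M. on_line p l}"
  obtain e g where e: "e \<le> d" and g: "minimal_vanishing e g U"
    using minimal_vanishing_exists [OF f(1,2), of U] f(3) unfolding U_def by blast
  have gU: "g l = 0" if "on_line p l" "p \<in> M" for p l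
    using g that unfolding minimal_vanishing_def U_def by blast
  obtain p0 where "p0 \<in> M" using M by blast
  then have "U \<noteq> {}" unfolding U_def using on_line_iff_light by (cases p0) blast
  from minimal_vanishing_hessian [OF g this]
  obtain gx gy gz gxx gxy gxz gyy gyz gzz where
    h: "has_hessian g gx gy gz gxx gxy gxz gyy gyz gzz" and "e > 0"
    and pol: "polyfun (e - 1) gx" "polyfun (e - 1) gy" "polyfun (e - 1) gz"
    and nz: "\<not> ((\<forall>p. gx p = 0) \<and> (\<forall>p. gy p = 0) \<and> (\<forall>p. gz p = 0))" .
  have grad: "has_grad g gx gy gz" using h by (simp add: has_hessian_def)
  \<comment> \<open>The derivative of \<open>g\<close> along the light line is quadratic in
    \<open>t\<close>. Distinct light lines through \<open>l\<close> have distinct \<open>t\<close>,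
    so three of them force all coefficients to vanish.\<close>
  have dir: "(- gx l) * t\<^sup>2 + gy l * t + gz l = 0" if tqw: "(t, q, w) \<in> M" "on_line (t, q, w) l" for t q w l
  proof -
    obtain s where s: "l = (w - q * t + s * (- t\<^sup>2), q + s * t, 0 + s * 1)"
      using tqw(2) on_line_iff_light by blast
    have "g (w - q * t + s * (- t\<^sup>2), q + s * t, 0 + s * 1) = 0" for s
      by (rule gU [OF _ tqw(1)]) (use on_line_iff_light in blast)
    from has_grad_vanishing_line [OF grad this, of s]
    show ?thesis unfolding s by (simp add: algebra_simps)
  qed
  have zero: "gx l = 0 \<and> gy l = 0 \<and> gz l = 0" if three: "card {p\<in>M. on_line p l} > 2" for l
  proof -
    from obtain_three [OF three] obtain p1 p2 p3 where
      p: "p1 \<in> M" "on_line p1 l" "p2 \<in> M" "on_line p2 l" "p3 \<in> M" "on_line p3 l" "p1 \<noteq> p2" "p1 \<noteq> p3" "p2 \<noteq> p3"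
      by (metis (mono_tags, lifting) mem_Collect_eq)
    have inj: "fst p \<noteq> fst p'" if "on_line p l" "on_line p' l" "p \<noteq> p'" for p p'
      using that by (cases p; cases p'; cases l) auto
    have quad: "(- gx l) * (fst p)\<^sup>2 + gy l * fst p + gz l = 0" if "p \<in> M" "on_line p l" for p
      using dir [of "fst p" "fst (snd p)" "snd (snd p)" l] that by simp
    have "- gx l = 0 \<and> gy l = 0 \<and> gz l = 0"
      using quad [OF p(1,2)] quad [OF p(3,4)] quad [OF p(5,6)]
        inj [OF p(2,4,7)] inj [OF p(2,6,8)] inj [OF p(4,6,9)]
      by (rule quadratic_three_roots)
    then show ?thesis by simp
  qed
  \<comment> \<open>Each line carries more than \<open>d \<ge> e\<close> triple points, so a
    polynomial of degree \<open>e - 1\<close> vanishing at all triple points vanishes on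
    \<open>U\<close>; the minimality of \<open>g\<close> then makes it zero everywhere.\<close>
  have line: "h l = 0" if h: "polyfun (e - 1) h" "\<And>l. card {p\<in>M. on_line p l} > 2 \<Longrightarrow> h l = 0"
    and l: "l \<in> U" for h l
  proof -
    obtain p where p: "p \<in> M" "on_line p l" using l unfolding U_def by blast
    obtain t q w where tqw: "p = (t, q, w)" by (metis prod_cases3)
    obtain s where s: "l = (w - q * t + s * (- t\<^sup>2), q + s * t, 0 + s * 1)"
      using p(2) on_line_iff_light tqw by blast
    show ?thesis
      unfolding s
    proof (rule polyfun_vanishes_on_line [OF h(1)])
      show "card {l\<in>N. on_line p l \<and> card {p'\<in>M. on_line p' l} > 2} > e - 1"
        using rich [OF p(1)] e by linarith
      show "h l = 0 \<and> (\<exists>s. l = (w - q * t + s * (- t\<^sup>2), q + s * t, 0 + s * 1))"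
        if "l \<in> {l\<in>N. on_line p l \<and> card {p'\<in>M. on_line p' l} > 2}" for l
        using that h(2) on_line_iff_light tqw by blast
    qed
  qed
  have "h l = 0" if "polyfun (e - 1) h" "\<And>l. card {p\<in>M. on_line p l} > 2 \<Longrightarrow> h l = 0" for h l
    using minimal_vanishing_lower [OF g \<open>e > 0\<close> that(1) line [OF that]] .
  then show False using nz pol zero by blast
qed

text \<open>The lines of the linear complex are tangent to the contact distribution spanned by
  \<open>V = \<partial>\<^sub>t + q \<partial>\<^sub>w\<close> and \<open>W = \<partial>\<^sub>q - t \<partial>\<^sub>w\<close>. At a point on two lines of the zero
  set both \<open>V g\<close> and \<open>W g\<close> vanish; once they vanish along all the lines, so does
  \<open>[V, W] g = - 2 \<partial>\<^sub>w g\<close>, which has smaller degree.\<close>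

lemma exists_contact_line_few_double_points:
  assumes M: "M \<noteq> {}" and f: "polyfun d f" "f r \<noteq> 0" "\<And>p l. l \<in> M \<Longrightarrow> on_line p l \<Longrightarrow> f p = 0"
  shows "\<exists>l\<in>M. card {p\<in>N. on_line p l \<and> card {l'\<in>M. on_line p l'} > 1} \<le> d"
proof (rule ccontr)
  assume "\<not> ?thesis"
  then have rich: "card {p\<in>N. on_line p l \<and> card {l'\<in>M. on_line p l'} > 1} > d" if "l \<in> M" for l
    using that by force
  define U where "U = {p. \<exists>l\<in>M. on_line p l}"
  obtain e g where e: "e \<le> d" and g: "minimal_vanishing e g U"
    using minimal_vanishing_exists [OF f(1,2), of U] f(3) unfolding U_def by blast
  have gU: "g p = 0" if "on_line p l" "l \<in> M" for p l
    using g that unfolding minimal_vanishing_def U_def by blast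
  obtain l0 where "l0 \<in> M" using M by blast
  then have "U \<noteq> {}" unfolding U_def using on_line_iff_contact by (cases l0) blast
  from minimal_vanishing_hessian [OF g this]
  obtain gx gy gz gxx gxy gxz gyy gyz gzz where
    h: "has_hessian g gx gy gz gxx gxy gxz gyy gyz gzz" and "e > 0"
    and pol: "polyfun (e - 1) gx" "polyfun (e - 1) gy" "polyfun (e - 1) gz"
    and nz: "\<not> ((\<forall>p. gx p = 0) \<and> (\<forall>p. gy p = 0) \<and> (\<forall>p. gz p = 0))" .
  have grad: "has_grad g gx gy gz" "has_grad gx gxx gxy gxz" "has_grad gy gxy gyy gyz" "has_grad gz gxz gyz gzz"
    using h by (auto simp: has_hessian_def)
  have two: "\<exists>A B C A' B' C'. (A, B, C) \<in> M \<and> (A', B', C') \<in> M \<and> on_line p (A, B, C) \<and> on_line p (A', B', C') \<and> C \<noteq> C'"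
    if c: "card {l'\<in>M. on_line p l'} > 1" for p
  proof -
    obtain l l' where l: "l \<in> M" "l' \<in> M" "on_line p l" "on_line p l'" "l \<noteq> l'"
      using obtain_two [OF c] by (metis (no_types, lifting) mem_Collect_eq)
    obtain A B C where "l = (A, B, C)" by (metis prod_cases3)
    moreover obtain A' B' C' where "l' = (A', B', C')" by (metis prod_cases3)
    moreover have "C \<noteq> C'" using l calculation by (cases p) auto
    ultimately show ?thesis using l by blast
  qed
  \<comment> \<open>The degree allowed is \<open>e\<close> rather than \<open>e - 1\<close> because
    \<open>V\<close> and \<open>W\<close> below multiply a derivative by a coordinate. For the same
    reason their vanishing on the lines is not yet within reach of minimality.\<close>
  have line: "k p = 0" if k: "polyfun e k" "\<And>p. card {l\<in>M. on_line p l} > 1 \<Longrightarrow> k p = 0"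
    and p: "on_line p (A, B, C)" "(A, B, C) \<in> M" for k p A B C
  proof -
    obtain s where s: "p = (0 + s * 1, B + s * (- C), A + s * B)"
      using p on_line_iff_contact by blast
    show ?thesis
      unfolding s
    proof (rule polyfun_vanishes_on_line [OF k(1)])
      show "card {p\<in>N. on_line p (A, B, C) \<and> card {l'\<in>M. on_line p l'} > 1} > e"
        using rich [OF p(2)] e by linarith
      show "k p = 0 \<and> (\<exists>s. p = (0 + s * 1, B + s * (- C), A + s * B))"
        if "p \<in> {p\<in>N. on_line p (A, B, C) \<and> card {l'\<in>M. on_line p l'} > 1}" for p
        using that k(2) on_line_iff_contact by blast
    qed
  qed
  have dir: "kx p + (- C) * ky p + B * kz p = 0"
    if k: "has_grad k kx ky kz" "\<And>p. on_line p (A, B, C) \<Longrightarrow> k p = 0" and p: "on_line p (A, B, C)"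
    for k kx ky kz p A B C
  proof -
    obtain s where s: "p = (0 + s * 1, B + s * (- C), A + s * B)"
      using p on_line_iff_contact by blast
    have "k (0 + s * 1, B + s * (- C), A + s * B) = 0" for s
      by (rule k(2)) (use on_line_iff_contact in blast)
    from has_grad_vanishing_line [OF k(1) this, of s]
    show ?thesis unfolding s by simp
  qed
  define V where "V = (\<lambda>p. gx p + fst (snd p) * gz p)"
  define W where "W = (\<lambda>p. gy p - fst p * gz p)"
  have pV: "polyfun e V" and pW: "polyfun e W"
    using pol polyfun.mult_x [of "e - 1" gz] polyfun.mult_y [of "e - 1" gz] \<open>e > 0\<close>
    unfolding V_def W_def by (auto intro!: polyfun.add polyfun_diff intro: polyfun_mono)
  have VW: "V p = 0 \<and> W p = 0" if "card {l\<in>M. on_line p l} > 1" for p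
  proof -
    obtain A B C A' B' C' where l: "(A, B, C) \<in> M" "(A', B', C') \<in> M" "on_line p (A, B, C)"
      "on_line p (A', B', C')" "C \<noteq> C'"
      using two [OF \<open>card {l\<in>M. on_line p l} > 1\<close>] by blast
    obtain t q w where p: "p = (t, q, w)" by (metis prod_cases3)
    have B: "B = q + C * t" "B' = q + C' * t" using l(3,4) p by auto
    have 1: "V p - C * W p = 0"
      using dir [OF grad(1) gU [OF _ l(1)] l(3)] by (simp add: V_def W_def p B algebra_simps)
    have 2: "V p - C' * W p = 0"
      using dir [OF grad(1) gU [OF _ l(2)] l(4)] by (simp add: V_def W_def p B algebra_simps)
    show ?thesis using linear_two_roots [OF 1 2 l(5)] .
  qed
  have V0: "V p = 0" and W0: "W p = 0" if "on_line p (A, B, C)" "(A, B, C) \<in> M" for p A B C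
    using line [OF pV _ that] line [OF pW _ that] VW by blast+
  have gV: "has_grad V (\<lambda>p. gxx p + fst (snd p) * gxz p) (\<lambda>p. gxy p + (fst (snd p) * gyz p + gz p))
      (\<lambda>p. gxz p + fst (snd p) * gzz p)"
    unfolding V_def by (intro has_grad_add has_grad_mult_y grad)
  have gW: "has_grad (\<lambda>p. (- 1) * W p) (\<lambda>p. - gxy p + (fst p * gxz p + gz p)) (\<lambda>p. - gyy p + fst p * gyz p)
      (\<lambda>p. - gyz p + fst p * gzz p)"
  proof -
    have eq: "(\<lambda>p. (- 1) * W p) = (\<lambda>p. - gy p + fst p * gz p)" by (auto simp: W_def)
    have "has_grad (\<lambda>p. - gy p) (\<lambda>p. - gxy p) (\<lambda>p. - gyy p) (\<lambda>p. - gyz p)"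
      unfolding has_grad_def Let_def
      by (intro allI, rule DERIV_cong [OF DERIV_minus [OF has_gradD [OF grad(3)]]]) (simp add: algebra_simps)
    then show ?thesis unfolding eq by (intro has_grad_add has_grad_mult_x grad)
  qed
  have gz0: "gz p = 0" if "card {l\<in>M. on_line p l} > 1" for p
  proof -
    obtain A B C A' B' C' where l: "(A, B, C) \<in> M" "(A', B', C') \<in> M" "on_line p (A, B, C)"
      "on_line p (A', B', C')" "C \<noteq> C'"
      using two [OF \<open>card {l\<in>M. on_line p l} > 1\<close>] by blast
    obtain t q w where p: "p = (t, q, w)" by (metis prod_cases3)
    have B: "B = q + C * t" "B' = q + C' * t" using l(3,4) p by auto
    \<comment> \<open>These are the values at \<open>p\<close> of \<open>V(V g)\<close>,
      \<open>W(V g)\<close>, \<open>V(W g)\<close> and \<open>W(W g)\<close>. A line with parameter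
      \<open>C\<close> through \<open>p\<close> has direction \<open>V - C W\<close>, and
      \<open>V g\<close> and \<open>W g\<close> vanish along it; two values of \<open>C\<close> give
      \<open>WV = 0\<close> and \<open>VW = 0\<close>, and \<open>WV - VW\<close> is
      \<open>2 * gz p\<close>.\<close>
    define VV where "VV = gxx p + 2 * q * gxz p + q * q * gzz p"
    define WV where "WV = gxy p - t * gxz p + q * gyz p + gz p - q * t * gzz p"
    define VW where "VW = gxy p - t * gxz p + q * gyz p - gz p - q * t * gzz p"
    define WW where "WW = gyy p - 2 * t * gyz p + t * t * gzz p"
    have "VV - C * WV = 0"
      using dir [OF gV V0 [OF _ l(1)] l(3)] by (simp add: VV_def WV_def p B algebra_simps)
    moreover have "VV - C' * WV = 0"
      using dir [OF gV V0 [OF _ l(2)] l(4)] by (simp add: VV_def WV_def p B algebra_simps)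
    ultimately have 1: "WV = 0" using linear_two_roots l(5) by blast
    have W0': "(- 1) * W p = 0" if "on_line p (A, B, C)" "(A, B, C) \<in> M" for p A B C
      using W0 [OF that] by simp
    have a: "VW - C * WW = 0"
      using dir [OF gW W0' [OF _ l(1)] l(3)] by (simp add: VW_def WW_def p B algebra_simps)
    have b: "VW - C' * WW = 0"
      using dir [OF gW W0' [OF _ l(2)] l(4)] by (simp add: VW_def WW_def p B algebra_simps)
    have "VW = 0" using linear_two_roots [OF a b l(5)] by blast
    then show ?thesis using 1 by (simp add: VW_def WV_def)
  qed
  have U: "\<exists>A B C. on_line p (A, B, C) \<and> (A, B, C) \<in> M" if p: "p \<in> U" for p
  proof -
    obtain l where l: "on_line p l" "l \<in> M" using p unfolding U_def by blast
    obtain A B C where "l = (A, B, C)" by (metis prod_cases3)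
    then show ?thesis using l by blast
  qed
  have pz: "polyfun e gz" by (rule polyfun_mono [OF pol(3)]) simp
  have gz: "gz p = 0" for p
  proof (rule minimal_vanishing_lower [OF g \<open>e > 0\<close> pol(3)])
    fix p assume "p \<in> U"
    then show "gz p = 0"
      using U line [OF pz gz0] by blast
  qed
  \<comment> \<open>With \<open>gz\<close> identically zero, \<open>V\<close> and \<open>W\<close>
    reduce to \<open>gx\<close> and \<open>gy\<close>. These have degree \<open>e - 1\<close>, so
    minimality now applies to them.\<close>
  have gx: "gx p = 0" for p
  proof (rule minimal_vanishing_lower [OF g \<open>e > 0\<close> pol(1)])
    fix p assume "p \<in> U"
    then have "V p = 0" using U V0 by blast
    then show "gx p = 0" by (simp add: V_def gz)
  qed
  have gy: "gy p = 0" for p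
  proof (rule minimal_vanishing_lower [OF g \<open>e > 0\<close> pol(2)])
    fix p assume "p \<in> U"
    then have "W p = 0" using U W0 by blast
    then show "gy p = 0" by (simp add: W_def gz)
  qed
  show False using nz gx gy gz by blast
qed

lemma light_incidences_vanishing:
  assumes "finite M" "finite N" and f: "polyfun d f" "f r \<noteq> 0" "\<And>p l. p \<in> M \<Longrightarrow> on_line p l \<Longrightarrow> f l = 0"
  shows "card {(p, l). p \<in> M \<and> l \<in> N \<and> on_line p l} \<le> d * card M + 2 * card N"
proof (rule incidence_peeling [OF assms(1,2)])
  fix M' assume "M' \<subseteq> M" "M' \<noteq> {}"
  then show "\<exists>p\<in>M'. card {l\<in>N. on_line p l \<and> card {p'\<in>M'. on_line p' l} > 2} \<le> d"
    using exists_light_line_few_triple_points [OF _ f(1,2), of M' N] f(3) by blast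
qed

lemma contact_incidences_vanishing:
  assumes "finite M" "finite N" and f: "polyfun d f" "f r \<noteq> 0" "\<And>p l. l \<in> M \<Longrightarrow> on_line p l \<Longrightarrow> f p = 0"
  shows "card {(l, p). l \<in> M \<and> p \<in> N \<and> on_line p l} \<le> d * card M + 1 * card N"
proof (rule incidence_peeling [OF assms(1,2), where R = "\<lambda>l p. on_line p l"])
  fix M' assume "M' \<subseteq> M" "M' \<noteq> {}"
  then show "\<exists>l\<in>M'. card {p\<in>N. on_line p l \<and> card {l'\<in>M'. on_line p l'} > 1} \<le> d"
    using exists_contact_line_few_double_points [OF _ f(1,2), of M' N] f(3) by blast
qed

section \<open>Polynomial partitioning\<close>

text \<open>The three base-\<open>e\<close> digits of \<open>n < e^3\<close> are the exponents of the \<open>n\<close>-th monomial.\<close>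

definition box_poly :: "nat \<Rightarrow> nat \<Rightarrow> (nat \<Rightarrow> real) \<Rightarrow> point3 \<Rightarrow> real" where
  "box_poly e N x p = (\<Sum>n\<le>N. x n * (fst p ^ (n mod e) * fst (snd p) ^ (n div e mod e) * snd (snd p) ^ (n div (e * e))))"

lemma polyfun_box_poly:
  assumes "N < e ^ 3"
  shows "polyfun (3 * e) (box_poly e N x)"
proof -
  have "polyfun (3 * e) (\<lambda>p. fst p ^ (n mod e) * fst (snd p) ^ (n div e mod e) * snd (snd p) ^ (n div (e * e)))"
    if "n \<le> N" for n
  proof (rule polyfun_mono [OF polyfun_monomial])
    have e: "e > 0" using assms by (cases e) auto
    have "n < e * (e * e)" using that assms by (simp add: power3_eq_cube mult.assoc)
    then have "n div (e * e) < e" using e by (simp add: div_less_iff_less_mult)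
    moreover have "n mod e < e" "n div e mod e < e" using e by simp_all
    ultimately show "n mod e + n div e mod e + n div (e * e) \<le> 3 * e" by linarith
  qed
  then show ?thesis
    unfolding box_poly_def by (intro polyfun_sum polyfun_cmult) auto
qed

text \<open>Kronecker substitution: on the curve \<open>(t, t^e, t^(e^2))\<close> the monomials become distinct powers of \<open>t\<close>.\<close>

lemma box_poly_nonzero:
  assumes "x j \<noteq> 0" "j \<le> N"
  shows "\<exists>p. box_poly e N x p \<noteq> 0"
proof -
  have "box_poly e N x (t, t ^ e, t ^ (e * e)) = poly (\<Sum>n\<le>N. Polynomial.monom (x n) n) t" for t
  proof -
    have "t ^ (n mod e) * (t ^ e) ^ (n div e mod e) * (t ^ (e * e)) ^ (n div (e * e)) = t ^ n" for n
    proof -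
      have "n mod e + e * (n div e mod e) + e * e * (n div (e * e)) = n mod e + e * (n div e mod e + e * (n div e div e))"
        by (simp only: div_mult2_eq distrib_left mult.assoc add.assoc)
      also have "\<dots> = n" by (simp only: mod_mult_div_eq)
      finally show ?thesis by (simp flip: power_mult power_add)
    qed
    then show ?thesis by (simp add: box_poly_def poly_sum poly_monom)
  qed
  moreover have "(\<Sum>n\<le>N. Polynomial.monom (x n) n) \<noteq> 0"
  proof
    assume "(\<Sum>n\<le>N. Polynomial.monom (x n) n) = 0"
    then have "Polynomial.coeff (\<Sum>n\<le>N. Polynomial.monom (x n) n) j = 0" by simp
    then show False using assms by (simp add: coeff_sum)
  qed
  then obtain t where "poly (\<Sum>n\<le>N. Polynomial.monom (x n) n) t \<noteq> 0" using poly_all_0_iff_0 by blast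
  ultimately show ?thesis by metis
qed

lemma hom_lipschitz_box_poly: "hom_lipschitz N (\<lambda>x. box_poly e N x p)"
proof -
  have "hom_lipschitz N (\<lambda>x. \<Sum>n\<le>N. (fst p ^ (n mod e) * fst (snd p) ^ (n div e mod e) * snd (snd p) ^ (n div (e * e))) * x n)"
    by (intro hom_lipschitz_sum hom_lipschitz_cmult hom_lipschitz_coord) auto
  then show ?thesis by (simp add: box_poly_def mult.commute)
qed

section \<open>Polynomial ham sandwich theorem\<close>

text \<open>Every point of \<open>T\<close> contributes exactly \<open>\<epsilon>\<close> and every
  other point at least \<open>-\<epsilon>\<close>; a zero sum leaves at least as many points outside
  \<open>T\<close> as inside.\<close>

lemma clamp_to_balanced:
  assumes "finite S" "T \<subseteq> S" "\<epsilon> > 0" "(\<Sum>p\<in>S. clamp_to \<epsilon> (v p)) = 0" "\<And>p. p \<in> T \<Longrightarrow> v p \<ge> \<epsilon>"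
  shows "2 * card T \<le> card S"
proof -
  have "(\<Sum>p\<in>S. clamp_to \<epsilon> (v p)) = (\<Sum>p\<in>T. clamp_to \<epsilon> (v p)) + (\<Sum>p\<in>S - T. clamp_to \<epsilon> (v p))"
    using assms(1,2) by (simp add: sum.subset_diff)
  moreover have "(\<Sum>p\<in>T. clamp_to \<epsilon> (v p)) = (\<Sum>p\<in>T. \<epsilon>)"
    using assms(3,5) by (intro sum.cong) (auto simp: clamp_to_def)
  moreover have "(\<Sum>p\<in>S - T. clamp_to \<epsilon> (v p)) \<ge> (\<Sum>p\<in>S - T. - \<epsilon>)"
    by (intro sum_mono) (simp add: clamp_to_def)
  ultimately have "0 \<ge> real (card T) * \<epsilon> - real (card (S - T)) * \<epsilon>" using assms(4) by simp
  then have "real (card T) * \<epsilon> \<le> real (card (S - T)) * \<epsilon>" by simp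
  then have "card T \<le> card (S - T)" using assms(3) by simp
  then show ?thesis using assms(1,2) by (simp add: card_Diff_subset finite_subset)
qed

lemma clamp_to_minus: "b \<ge> 0 \<Longrightarrow> clamp_to b (- s) = - clamp_to b s"
  unfolding clamp_to_def by linarith

text \<open>There are \<open>N + 1\<close> free coefficients for \<open>N\<close> conditions, so
  Borsuk--Ulam applies once counting signs is replaced by summing clamped values. The clamping width
  is sent to 0 along a convergent sequence of normalized coefficient vectors: where the limit
  \<open>f\<close> is positive or negative, the approximating values eventually exceed the width, so
  the clamped balance becomes a bound on cardinalities.\<close>

theorem polynomial_ham_sandwich:
  fixes S :: "nat \<Rightarrow> point3 set"
  assumes fin: "\<And>i. i < N \<Longrightarrow> finite (S i)" and N: "N < e ^ 3"
  shows "\<exists>f. polyfun (3 * e) f \<and> (\<exists>p. f p \<noteq> 0) \<and>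
           (\<forall>i<N. 2 * card {p\<in>S i. f p > 0} \<le> card (S i) \<and> 2 * card {p\<in>S i. f p < 0} \<le> card (S i))"
proof -
  define K where "K = {x::nat \<Rightarrow> real. \<forall>i. \<bar>x i\<bar> \<le> 1} \<inter> ({x. \<forall>i>N. x i = 0} \<inter> {x. (\<Sum>j\<le>N. \<bar>x j\<bar>) = 1})"
  have "compact K" unfolding K_def by (rule compact_l1_sphere)
  have "\<exists>x\<in>K. \<forall>i<N. (\<Sum>p\<in>S i. clamp_to \<epsilon> (box_poly e N x p)) = 0" if \<epsilon>: "\<epsilon> > 0" for \<epsilon>
  proof -
    define b where "b x = \<epsilon> * (\<Sum>j\<le>N. \<bar>x j\<bar>)" for x :: "nat \<Rightarrow> real"
    have b_lip: "\<bar>b x - b y\<bar> \<le> \<epsilon> * (\<Sum>j\<le>N. \<bar>x j - y j\<bar>)" for x y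
    proof -
      have "\<bar>(\<Sum>j\<le>N. \<bar>x j\<bar>) - (\<Sum>j\<le>N. \<bar>y j\<bar>)\<bar> = \<bar>\<Sum>j\<le>N. \<bar>x j\<bar> - \<bar>y j\<bar>\<bar>" by (simp add: sum_subtractf)
      also have "\<dots> \<le> (\<Sum>j\<le>N. \<bar>\<bar>x j\<bar> - \<bar>y j\<bar>\<bar>)" by (rule sum_abs)
      also have "\<dots> \<le> (\<Sum>j\<le>N. \<bar>x j - y j\<bar>)" by (intro sum_mono) linarith
      finally show ?thesis using \<epsilon> by (simp add: b_def abs_mult flip: right_diff_distrib)
    qed
    have b_scale: "b (\<lambda>j. t * x j) = \<bar>t\<bar> * b x" for t x
      by (simp add: b_def abs_mult sum_distrib_left mult_ac)
    have b_nonneg: "b x \<ge> 0" for x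
      using \<epsilon> by (simp add: b_def sum_nonneg)
    define H where "H x i = (\<Sum>p\<in>S i. clamp_to (b x) (box_poly e N x p))" for x i
    have H: "hom_lipschitz N (\<lambda>x. H x i)" for i
      unfolding H_def
      by (intro hom_lipschitz_sum hom_lipschitz_clamp_to [OF hom_lipschitz_box_poly b_lip b_scale b_nonneg])
        (use \<epsilon> in simp)
    obtain x where x: "\<exists>j\<le>N. x j \<noteq> 0" "\<forall>i<N. H x i = 0"
      using Borsuk_Ulam_hom_lipschitz [of N H] H by blast
    define s where "s = (\<Sum>j\<le>N. \<bar>x j\<bar>)"
    obtain j where j: "j \<le> N" "x j \<noteq> 0" using x(1) by blast
    have "\<bar>x j\<bar> \<le> s" unfolding s_def by (rule member_le_sum) (use j in auto)
    then have s: "s > 0" using j by linarith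
    define y where "y = (\<lambda>j. if j \<le> N then (1 / s) * x j else 0)"
    have sy: "(\<Sum>j\<le>N. \<bar>y j\<bar>) = 1"
      using s by (simp add: y_def s_def sum_divide_distrib [symmetric])
    have "\<bar>y j\<bar> \<le> 1" for j
    proof (cases "j \<le> N")
      case True
      then have "\<bar>y j\<bar> \<le> (\<Sum>j\<le>N. \<bar>y j\<bar>)" by (intro member_le_sum) auto
      then show ?thesis using sy by simp
    qed (simp add: y_def)
    then have "y \<in> K" using sy by (simp add: K_def y_def)
    moreover have "(\<Sum>p\<in>S i. clamp_to \<epsilon> (box_poly e N y p)) = 0" if "i < N" for i
    proof -
      have "H y i = H (\<lambda>j. (1 / s) * x j) i"
        by (rule hom_lipschitz_cong [OF H]) (simp add: y_def)
      also have "\<dots> = (1 / s) * H x i" by (rule hom_lipschitz_scale [OF H])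
      finally show ?thesis using x(2) that sy by (simp add: H_def b_def)
    qed
    ultimately show ?thesis by blast
  qed
  then have "\<forall>k. \<exists>x. x \<in> K \<and> (\<forall>i<N. (\<Sum>p\<in>S i. clamp_to (inverse (real (Suc k))) (box_poly e N x p)) = 0)"
    by (metis inverse_positive_iff_positive of_nat_0_less_iff zero_less_Suc)
  then obtain X where X: "\<And>k. X k \<in> K"
    "\<And>k i. i < N \<Longrightarrow> (\<Sum>p\<in>S i. clamp_to (inverse (real (Suc k))) (box_poly e N (X k) p)) = 0"
    by metis
  obtain x r where x: "x \<in> K" and r: "strict_mono r" and lim: "(X \<circ> r) \<longlonglongrightarrow> x"
    using compact_imp_seq_compact [OF \<open>compact K\<close>] X(1) unfolding seq_compact_def by metis
  define f where "f = box_poly e N x"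
  have "\<exists>j\<le>N. x j \<noteq> 0"
  proof (rule ccontr)
    assume "\<not> ?thesis"
    then have "(\<Sum>j\<le>N. \<bar>x j\<bar>) = 0" by (intro sum.neutral) auto
    with x show False by (simp add: K_def)
  qed
  then have nz: "\<exists>p. f p \<noteq> 0" unfolding f_def using box_poly_nonzero by blast
  have limf: "(\<lambda>k. box_poly e N (X (r k)) p) \<longlonglongrightarrow> f p" for p
    unfolding f_def
    using continuous_on_tendsto_compose [OF hom_lipschitz_continuous [OF hom_lipschitz_box_poly [of N e p]] lim]
    by (simp add: o_def)
  have lim0: "(\<lambda>k. inverse (real (Suc (r k)))) \<longlonglongrightarrow> 0"
    using LIMSEQ_subseq_LIMSEQ [OF LIMSEQ_inverse_real_of_nat r] by (simp add: o_def)
  have half: "2 * card {p\<in>S i. u * f p > 0} \<le> card (S i)" if i: "i < N" and u: "u = 1 \<or> u = -1" for i u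
  proof -
    have "eventually (\<lambda>k. inverse (real (Suc (r k))) < u * box_poly e N (X (r k)) p) sequentially"
      if "u * f p > 0" for p
    proof -
      have "(\<lambda>k. u * box_poly e N (X (r k)) p - inverse (real (Suc (r k)))) \<longlonglongrightarrow> u * f p - 0"
        by (intro tendsto_intros limf lim0)
      then have "eventually (\<lambda>k. 0 < u * box_poly e N (X (r k)) p - inverse (real (Suc (r k)))) sequentially"
        using that by (intro order_tendstoD) auto
      then show ?thesis by (rule eventually_mono) simp
    qed
    then have "eventually (\<lambda>k. \<forall>p\<in>{p\<in>S i. u * f p > 0}. inverse (real (Suc (r k))) < u * box_poly e N (X (r k)) p) sequentially"
      using fin [OF i] by (intro eventually_ball_finite) auto
    then obtain k where k: "\<forall>p\<in>{p\<in>S i. u * f p > 0}. inverse (real (Suc (r k))) < u * box_poly e N (X (r k)) p"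
      using eventually_sequentially by auto
    show ?thesis
    proof (rule clamp_to_balanced [OF fin [OF i], where \<epsilon> = "inverse (real (Suc (r k)))" and v = "\<lambda>p. u * box_poly e N (X (r k)) p"])
      have "clamp_to (inverse (real (Suc (r k)))) (u * s) = u * clamp_to (inverse (real (Suc (r k)))) s" for s
        using u by (auto simp: clamp_to_minus)
      then show "(\<Sum>p\<in>S i. clamp_to (inverse (real (Suc (r k)))) (u * box_poly e N (X (r k)) p)) = 0"
        using X(2) [OF i, of "r k"] by (simp flip: sum_distrib_left)
    qed (use k in \<open>auto intro: less_imp_le\<close>)
  qed
  have "2 * card {p\<in>S i. f p > 0} \<le> card (S i) \<and> 2 * card {p\<in>S i. f p < 0} \<le> card (S i)" if "i < N" for i
    using half [OF that, of 1] half [OF that, of "-1"] by simp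
  then show ?thesis
    using polyfun_box_poly [OF N] nz unfolding f_def by blast
qed

section \<open>Cells given by sign vectors\<close>

text \<open>Step \<open>J\<close> bisects all \<open>2 ^ J\<close> classes at once. This requires
  \<open>2 ^ J < e ^ 3\<close>, which \<open>e = 2 ^ (J div 3 + 1)\<close> satisfies since
  \<open>J < 3 * (J div 3 + 1)\<close>. Points on a zero set belong to no cell.\<close>

lemma sign_cells:
  assumes fin: "finite (P :: point3 set)"
  shows "\<exists>F. (\<forall>j<J. polyfun (3 * 2 ^ (j div 3 + 1)) (F j) \<and> (\<exists>p. F j p \<noteq> 0)) \<and>
           (\<forall>s. 2 ^ J * card {p\<in>P. \<forall>j<J. F j p \<noteq> 0 \<and> sgn (F j p) = s j} \<le> card P)"
proof (induction J)
  case 0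
  show ?case by simp
next
  case (Suc J)
  then obtain F :: "nat \<Rightarrow> point3 \<Rightarrow> real" where
    F: "\<And>j. j < J \<Longrightarrow> polyfun (3 * 2 ^ (j div 3 + 1)) (F j) \<and> (\<exists>p. F j p \<noteq> 0)"
       "\<And>s. 2 ^ J * card {p\<in>P. \<forall>j<J. F j p \<noteq> 0 \<and> sgn (F j p) = s j} \<le> card P"
    by blast
  define T where "T s = {p\<in>P. \<forall>j<J. F j p \<noteq> 0 \<and> sgn (F j p) = s j}" for s :: "nat \<Rightarrow> real"
  have finT: "finite (T s)" for s using fin by (simp add: T_def)
  \<comment> \<open>Only sign vectors with values 1 and -1 can have points in their class. The
    enumeration \<open>h\<close> passes the classes to one simultaneous bisection.\<close>
  define Sg where "Sg = (\<Pi>\<^sub>E j\<in>{..<J}. {1, -1::real})"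
  have "finite Sg" unfolding Sg_def by (intro finite_PiE) auto
  moreover have "card Sg = 2 ^ J" by (simp add: Sg_def card_PiE numeral_2_eq_2)
  ultimately obtain h where h: "bij_betw h {..<(2::nat) ^ J} Sg"
    by (metis ex_bij_betw_nat_finite lessThan_atLeast0)
  have "(2::nat) ^ J < (2 ^ (J div 3 + 1)) ^ 3"
  proof -
    have "J < (J div 3 + 1) * 3" by presburger
    then show ?thesis by (simp only: power_mult [symmetric]) (rule power_strict_increasing, auto)
  qed
  from polynomial_ham_sandwich [of "2 ^ J" "\<lambda>i. T (h i)", OF finT this]
  obtain f where f: "polyfun (3 * 2 ^ (J div 3 + 1)) f" "\<exists>p. f p \<noteq> 0"
    "\<And>i. i < 2 ^ J \<Longrightarrow> 2 * card {p\<in>T (h i). f p > 0} \<le> card (T (h i)) \<and> 2 * card {p\<in>T (h i). f p < 0} \<le> card (T (h i))"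
    by blast
  have half: "2 * card {p\<in>T s. f p > 0} \<le> card (T s) \<and> 2 * card {p\<in>T s. f p < 0} \<le> card (T s)"
    if s: "s \<in> Sg" for s
  proof -
    obtain i where "i < 2 ^ J" "s = h i" using h s unfolding bij_betw_def by blast
    then show ?thesis using f(3) by blast
  qed
  define F' where "F' = F(J := f)"
  have "2 ^ Suc J * card {p\<in>P. \<forall>j<Suc J. F' j p \<noteq> 0 \<and> sgn (F' j p) = s j} \<le> card P" for s
  proof (cases "{p\<in>P. \<forall>j<Suc J. F' j p \<noteq> 0 \<and> sgn (F' j p) = s j} = {}")
    case True
    then show ?thesis by (simp only: card.empty)
  next
    case False
    then obtain p where p: "p \<in> P" "\<And>j. j < Suc J \<Longrightarrow> F' j p \<noteq> 0 \<and> sgn (F' j p) = s j" by blast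
    have s: "s j = 1 \<or> s j = -1" if "j < Suc J" for j
      using p(2) [OF that] by (auto simp: sgn_if split: if_splits)
    define s' where "s' = restrict s {..<J}"
    have "s' \<in> Sg" using s by (auto simp: s'_def Sg_def)
    have sub: "{p\<in>P. \<forall>j<Suc J. F' j p \<noteq> 0 \<and> sgn (F' j p) = s j} \<subseteq>
        {p\<in>T s'. f p \<noteq> 0 \<and> sgn (f p) = s J}"
      by (auto simp: T_def F'_def s'_def less_Suc_eq split: if_splits)
    have "2 * card {p\<in>P. \<forall>j<Suc J. F' j p \<noteq> 0 \<and> sgn (F' j p) = s j} \<le> card (T s')"
    proof (cases "s J = 1")
      case True
      have "{p\<in>T s'. f p \<noteq> 0 \<and> sgn (f p) = s J} = {p\<in>T s'. f p > 0}"
        using True by (auto simp: sgn_if split: if_splits)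
      then have "card {p\<in>P. \<forall>j<Suc J. F' j p \<noteq> 0 \<and> sgn (F' j p) = s j} \<le> card {p\<in>T s'. f p > 0}"
        using sub finT by (intro card_mono) auto
      then show ?thesis using half [OF \<open>s' \<in> Sg\<close>] by linarith
    next
      case False
      then have "s J = -1" using s [of J] by simp
      then have "{p\<in>T s'. f p \<noteq> 0 \<and> sgn (f p) = s J} = {p\<in>T s'. f p < 0}"
        by (auto simp: sgn_if split: if_splits)
      then have "card {p\<in>P. \<forall>j<Suc J. F' j p \<noteq> 0 \<and> sgn (F' j p) = s j} \<le> card {p\<in>T s'. f p < 0}"
        using sub finT by (intro card_mono) auto
      then show ?thesis using half [OF \<open>s' \<in> Sg\<close>] by linarith
    qed
    then have "2 ^ J * (2 * card {p\<in>P. \<forall>j<Suc J. F' j p \<noteq> 0 \<and> sgn (F' j p) = s j}) \<le> 2 ^ J * card (T s')"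
      by (rule mult_left_mono) simp
    also have "\<dots> \<le> card P" using F(2) [of s'] by (simp add: T_def)
    finally show ?thesis by (simp add: mult.assoc mult.left_commute)
  qed
  moreover have "\<forall>j<Suc J. polyfun (3 * 2 ^ (j div 3 + 1)) (F' j) \<and> (\<exists>p. F' j p \<noteq> 0)"
    using F(1) f(1,2) by (auto simp: F'_def less_Suc_eq)
  ultimately show ?case by blast
qed

lemma card_image_le_card_image:
  assumes fin: "finite (v ` A)" and "\<And>t t'. t \<in> A \<Longrightarrow> t' \<in> A \<Longrightarrow> v t = v t' \<Longrightarrow> g t = g t'"
  shows "finite (g ` A) \<and> card (g ` A) \<le> card (v ` A)"
proof -
  have "g ` A \<subseteq> (\<lambda>k. g (SOME t. t \<in> A \<and> v t = k)) ` (v ` A)"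
  proof (clarsimp simp: image_image)
    fix t assume t: "t \<in> A"
    have "(SOME t'. t' \<in> A \<and> v t' = v t) \<in> A \<and> v (SOME t'. t' \<in> A \<and> v t' = v t) = v t"
      by (rule someI [of _ t]) (use t in simp)
    then have "g t = g (SOME t'. t' \<in> A \<and> v t' = v t)" using assms(2) t by metis
    then show "g t \<in> (\<lambda>t. g (SOME t'. t' \<in> A \<and> v t' = v t)) ` A" using t by blast
  qed
  then show ?thesis
    using fin by (meson finite_imageI finite_subset surj_card_le)
qed

lemma poly_sgn_eq:
  fixes q :: "real poly"
  assumes "t \<le> t'" "\<And>r. t \<le> r \<Longrightarrow> r \<le> t' \<Longrightarrow> poly q r \<noteq> 0"
  shows "sgn (poly q t) = sgn (poly q t')"
proof (rule ccontr)
  assume ne: "sgn (poly q t) \<noteq> sgn (poly q t')"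
  have "poly q t \<noteq> 0" "poly q t' \<noteq> 0" using assms by auto
  moreover have "t < t'" using ne assms(1) by (cases "t = t'") auto
  ultimately consider "poly q t < 0" "0 < poly q t'" | "0 < poly q t" "poly q t' < 0"
    using ne by (auto simp: sgn_if split: if_splits)
  then show False
  proof cases
    case 1
    then show False using poly_IVT_pos [OF \<open>t < t'\<close>] assms(2) less_imp_le by metis
  next
    case 2
    then show False using poly_IVT_neg [OF \<open>t < t'\<close>] assms(2) less_imp_le by metis
  qed
qed

text \<open>The sign vector at a point of the line off the zero set depends only on the number of
  zeros of the product that precede it.\<close>

lemma line_sign_vectors:
  fixes F :: "nat \<Rightarrow> point3 \<Rightarrow> real"
  assumes F: "\<And>j. j < J \<Longrightarrow> polyfun (d j) (F j)"
  defines "\<sigma> \<equiv> \<lambda>p j. if j < J then sgn (F j p) else (0::real)"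
  shows "finite (\<sigma> ` {p. (\<Prod>j<J. F j p) \<noteq> 0 \<and> (\<exists>t. p = (x + t * a, y + t * b, z + t * c))}) \<and>
    card (\<sigma> ` {p. (\<Prod>j<J. F j p) \<noteq> 0 \<and> (\<exists>t. p = (x + t * a, y + t * b, z + t * c))}) \<le> (\<Sum>j<J. d j) + 1"
proof -
  define g where "g t = (x + t * a, y + t * b, z + t * c)" for t
  have "\<forall>j. \<exists>q. j < J \<longrightarrow> degree q \<le> d j \<and> (\<forall>t. F j (g t) = poly q t)"
    unfolding g_def using F polyfun_restrict_line by metis
  then obtain q where q: "\<And>j. j < J \<Longrightarrow> degree (q j) \<le> d j" "\<And>j t. j < J \<Longrightarrow> F j (g t) = poly (q j) t"
    by metis
  define Q where "Q = (\<Prod>j<J. q j)"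
  have Q: "(\<Prod>j<J. F j (g t)) = poly Q t" for t
    unfolding Q_def poly_prod by (intro prod.cong) (auto simp: q)
  have degQ: "degree Q \<le> (\<Sum>j<J. d j)"
    unfolding Q_def using degree_prod_sum_le [of "{..<J}" q] sum_mono [of "{..<J}" "\<lambda>j. degree (q j)" d] q(1)
    by (force simp: o_def)
  define A where "A = {t. poly Q t \<noteq> 0}"
  have img: "\<sigma> ` {p. (\<Prod>j<J. F j p) \<noteq> 0 \<and> (\<exists>t. p = (x + t * a, y + t * b, z + t * c))} = (\<lambda>t. \<sigma> (g t)) ` A"
    unfolding A_def Q [symmetric] by (auto simp: g_def image_iff)
  show ?thesis
  proof (cases "Q = 0")
    \<comment> \<open>The line lies in the zero set, so it contributes no sign vector.\<close>
    case True
    then show ?thesis unfolding img by (simp add: A_def)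
  next
    case False
    define R where "R = {t. poly Q t = 0}"
    have finR: "finite R" unfolding R_def using False by (rule poly_roots_finite)
    have cardR: "card R \<le> (\<Sum>j<J. d j)"
      unfolding R_def using card_poly_roots_bound [OF False] degQ by linarith
    define v where "v t = card {r\<in>R. r < t}" for t
    have v: "v ` A \<subseteq> {..(\<Sum>j<J. d j)}"
    proof clarsimp
      fix t
      have "v t \<le> card R" unfolding v_def using finR by (intro card_mono) auto
      then show "v t \<le> (\<Sum>j<J. d j)" using cardR by simp
    qed
    have eq: "\<sigma> (g t) = \<sigma> (g t')" if t: "t \<in> A" "t' \<in> A" "v t = v t'" "t \<le> t'" for t t'
    proof -
      have sub: "{r\<in>R. r < t} = {r\<in>R. r < t'}"
        using t(3,4) finR unfolding v_def by (intro card_subset_eq) auto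
      have noroot: "poly Q r \<noteq> 0" if "t \<le> r" "r \<le> t'" for r
      proof
        assume r: "poly Q r = 0"
        then have "r \<noteq> t'" using t(2) by (auto simp: A_def)
        then have "r \<in> {r\<in>R. r < t'}" using that r by (simp add: R_def)
        then have "r \<in> {r\<in>R. r < t}" unfolding sub .
        then show False using that(1) by simp
      qed
      have "sgn (poly (q j) t) = sgn (poly (q j) t')" if j: "j < J" for j
      proof (rule poly_sgn_eq [OF t(4)])
        fix r assume "t \<le> r" "r \<le> t'"
        then have "poly Q r \<noteq> 0" by (rule noroot)
        moreover have "poly Q r = 0" if "poly (q j) r = 0"
          unfolding Q_def poly_prod by (rule prod_zero) (use j that in auto)
        ultimately show "poly (q j) r \<noteq> 0" by blast
      qed
      then show ?thesis by (auto simp: \<sigma>_def q)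
    qed
    have eq': "\<sigma> (g t) = \<sigma> (g t')" if "t \<in> A" "t' \<in> A" "v t = v t'" for t t'
      using linear [of t t']
    proof
      assume "t \<le> t'"
      then show ?thesis using eq that by blast
    next
      assume "t' \<le> t"
      then show ?thesis using eq [OF that(2,1) that(3) [symmetric]] by simp
    qed
    have "finite (v ` A)" using v finite_subset by blast
    then have "finite ((\<lambda>t. \<sigma> (g t)) ` A) \<and> card ((\<lambda>t. \<sigma> (g t)) ` A) \<le> card (v ` A)"
      by (rule card_image_le_card_image) (rule eq')
    moreover have "card (v ` A) \<le> (\<Sum>j<J. d j) + 1"
      using card_mono [OF _ v] by simp
    ultimately show ?thesis unfolding img by linarith
  qed
qed

text \<open>Three consecutive indices share one degree, so the sum is geometric with terms
  \<open>18 * 2 ^ k\<close> for \<open>k < K\<close>. The exact value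
  \<open>18 * 2 ^ K - 18\<close>, written without subtraction, is what the induction proves.\<close>

lemma sum_degrees: "(\<Sum>j<3 * K. 3 * 2 ^ (j div 3 + 1)) \<le> (18 * 2 ^ K :: nat)"
proof -
  have "(\<Sum>j<3 * K. 3 * 2 ^ (j div 3 + 1)) + 18 = (18 * 2 ^ K :: nat)"
  proof (induction K)
    case (Suc K)
    have 1: "3 * Suc K = Suc (Suc (Suc (3 * K)))" by simp
    have 2: "3 * K div 3 = K" "Suc (3 * K) div 3 = K" "Suc (Suc (3 * K)) div 3 = K" by simp_all
    show ?case unfolding 1 sum.lessThan_Suc 2 using Suc by simp
  qed simp
  then show ?thesis by linarith
qed

text \<open>Here \<open>2 ^ K\<close> plays the role of \<open>D\<close>: \<open>3 * K\<close>
  bisections give \<open>8 ^ K\<close>, that is \<open>D^3\<close>, sign classes, and their degrees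
  grow geometrically to \<open>O(D)\<close>. Cells are sign classes rather than connected
  components; \<open>\<sigma>\<close> is the label of a cell, and a line sees at most one more label
  than its number of zeros.\<close>

theorem polynomial_partition:
  assumes fin: "finite (P :: point3 set)"
  shows "\<exists>d f (\<sigma> :: point3 \<Rightarrow> nat \<Rightarrow> real).
    polyfun d f \<and> (\<exists>p. f p \<noteq> 0) \<and> d \<le> 18 * 2 ^ K \<and>
    (\<forall>s. 8 ^ K * card {p\<in>P. f p \<noteq> 0 \<and> \<sigma> p = s} \<le> card P) \<and>
    (\<forall>x y z a b c. finite (\<sigma> ` {p. f p \<noteq> 0 \<and> (\<exists>t. p = (x + t * a, y + t * b, z + t * c))}) \<and>
       card (\<sigma> ` {p. f p \<noteq> 0 \<and> (\<exists>t. p = (x + t * a, y + t * b, z + t * c))}) \<le> d + 1)"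
proof -
  define J where "J = 3 * K"
  define d where "d = (\<Sum>j<J. 3 * 2 ^ (j div 3 + 1) :: nat)"
  obtain F :: "nat \<Rightarrow> point3 \<Rightarrow> real" where
    F: "\<And>j. j < J \<Longrightarrow> polyfun (3 * 2 ^ (j div 3 + 1)) (F j)" "\<And>j. j < J \<Longrightarrow> \<exists>p. F j p \<noteq> 0"
       "\<And>s. 2 ^ J * card {p\<in>P. \<forall>j<J. F j p \<noteq> 0 \<and> sgn (F j p) = s j} \<le> card P"
    using sign_cells [OF fin, of J] by blast
  define f where "f p = (\<Prod>j<J. F j p)" for p
  define \<sigma> where "\<sigma> = (\<lambda>p j. if j < J then sgn (F j p) else (0::real))"
  show ?thesis
  proof (intro exI [of _ d] exI [of _ f] exI [of _ \<sigma>] conjI allI)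
    show "polyfun d f" unfolding d_def f_def using F(1) by (intro polyfun_prod) auto
    show "\<exists>p. f p \<noteq> 0" unfolding f_def by (rule polyfun_prod_nonzero [OF _ F(1,2)]) auto
    show "d \<le> 18 * 2 ^ K" unfolding d_def J_def by (rule sum_degrees)
    show "8 ^ K * card {p\<in>P. f p \<noteq> 0 \<and> \<sigma> p = s} \<le> card P" for s
    proof -
      have "{p\<in>P. f p \<noteq> 0 \<and> \<sigma> p = s} \<subseteq> {p\<in>P. \<forall>j<J. F j p \<noteq> 0 \<and> sgn (F j p) = s j}"
        by (auto simp: f_def \<sigma>_def)
      then have "card {p\<in>P. f p \<noteq> 0 \<and> \<sigma> p = s} \<le> card {p\<in>P. \<forall>j<J. F j p \<noteq> 0 \<and> sgn (F j p) = s j}"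
        using fin by (intro card_mono) auto
      then have "2 ^ J * card {p\<in>P. f p \<noteq> 0 \<and> \<sigma> p = s} \<le> card P"
        using F(3) [of s] by (meson le_trans mult_le_mono2)
      then show ?thesis by (simp add: J_def power_mult)
    qed
    fix x y z a b c
    show "finite (\<sigma> ` {p. f p \<noteq> 0 \<and> (\<exists>t. p = (x + t * a, y + t * b, z + t * c))})"
      "card (\<sigma> ` {p. f p \<noteq> 0 \<and> (\<exists>t. p = (x + t * a, y + t * b, z + t * c))}) \<le> d + 1"
      unfolding f_def \<sigma>_def d_def
      using line_sign_vectors [of J "\<lambda>j. 3 * 2 ^ (j div 3 + 1)" F, OF F(1)] by blast+
  qed
qed

section \<open>The incidence bound\<close>

text \<open>Bisecting a one-point set forces a zero there: a nonzero sign at the point would give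
  \<open>2 \<le> 1\<close>.\<close>

lemma vanishing_polynomial:
  assumes "finite A" "card A < e ^ 3"
  shows "\<exists>f. polyfun (3 * e) f \<and> (\<exists>p. f p \<noteq> 0) \<and> (\<forall>p\<in>A. f p = 0)"
proof -
  obtain h where h: "bij_betw h {..<card A} A"
    using ex_bij_betw_nat_finite [OF assms(1)] by (auto simp: atLeast0LessThan)
  obtain f where f: "polyfun (3 * e) f" "\<exists>p. f p \<noteq> 0"
    "\<And>i. i < card A \<Longrightarrow> 2 * card {p\<in>{h i}. f p > 0} \<le> card {h i} \<and> 2 * card {p\<in>{h i}. f p < 0} \<le> card {h i}"
    using polynomial_ham_sandwich [of "card A" "\<lambda>i. {h i}", OF _ assms(2)] by auto
  have "f (h i) = 0" if "i < card A" for i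
  proof (rule ccontr)
    assume "f (h i) \<noteq> 0"
    then consider "f (h i) > 0" | "f (h i) < 0" by linarith
    then show False
    proof cases
      case 1
      then have "{p\<in>{h i}. f p > 0} = {h i}" by auto
      then show False using f(3) [OF that] by simp
    next
      case 2
      then have "{p\<in>{h i}. f p < 0} = {h i}" by auto
      then show False using f(3) [OF that] by simp
    qed
  qed
  then have "\<forall>p\<in>A. f p = 0" using h unfolding bij_betw_def by (metis imageE lessThan_iff)
  then show ?thesis using f by blast
qed

text \<open>Vanishing at \<open>3 * e + 1\<close> points of each light line suffices for degree
  \<open>3 * e\<close>. The choice of \<open>e\<close> gives \<open>4 * m \<le> e ^ 2\<close>, hence
  \<open>m * (3 * e + 1) < m * (4 * e) \<le> e ^ 3\<close>; the constant 9 comes from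
  \<open>e \<le> 2 * sqrt m + 1 \<le> 3 * sqrt m\<close>.\<close>

lemma light_polynomial:
  assumes fin: "finite M" and ne: "M \<noteq> {}"
  shows "\<exists>d f r. polyfun d f \<and> f r \<noteq> 0 \<and> (\<forall>p\<in>M. \<forall>l. on_line p l \<longrightarrow> f l = 0) \<and> real d \<le> 9 * sqrt (real (card M))"
proof -
  define m where "m = card M"
  have m: "m \<ge> 1" using fin ne by (simp add: m_def Suc_le_eq card_gt_0_iff)
  define e where "e = nat \<lceil>2 * sqrt (real m)\<rceil>"
  have sq: "sqrt (real m) \<ge> 1" using m by simp
  have e1: "real e \<ge> 2 * sqrt (real m)" unfolding e_def by linarith
  have e2: "real e \<le> 2 * sqrt (real m) + 1" unfolding e_def using sq by linarith
  have "real e ^ 2 \<ge> (2 * sqrt (real m)) ^ 2" using e1 by (intro power_mono) auto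
  then have "4 * real m \<le> real (e ^ 2)" by (simp add: power_mult_distrib)
  then have e4: "4 * m \<le> e ^ 2" by (metis of_nat_le_iff of_nat_mult of_nat_numeral)
  have "real e > 1" using e1 sq by linarith
  then have e1': "e > 1" by simp
  define pt :: "point3 \<Rightarrow> real \<Rightarrow> point3"
    where "pt = (\<lambda>(t, q, w) s. (w - q * t + s * (- t\<^sup>2), q + s * t, 0 + s * 1))"
  define A where "A = (\<lambda>(p, k). pt p (real k)) ` (M \<times> {..3 * e})"
  have finA: "finite A" unfolding A_def using fin by simp
  have "card A \<le> card (M \<times> {..3 * e})" unfolding A_def using fin by (intro card_image_le) simp
  also have "\<dots> = m * (3 * e + 1)" by (simp add: m_def card_cartesian_product)
  also have "\<dots> < m * (4 * e)" using m e1' by (intro mult_strict_left_mono) auto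
  also have "\<dots> \<le> e ^ 3" using mult_right_mono [OF e4, of e] by (simp add: power2_eq_square power3_eq_cube mult.assoc mult.commute [of m])
  finally obtain f where f: "polyfun (3 * e) f" "\<exists>p. f p \<noteq> 0" "\<forall>p\<in>A. f p = 0"
    using vanishing_polynomial [OF finA] by blast
  have "f l = 0" if p: "p \<in> M" "on_line p l" for p l
  proof -
    obtain t q w where tqw: "p = (t, q, w)" by (metis prod_cases3)
    obtain s where s: "l = (w - q * t + s * (- t\<^sup>2), q + s * t, 0 + s * 1)"
      using p(2) on_line_iff_light tqw by blast
    show ?thesis
      unfolding s
    proof (rule polyfun_vanishes_on_line [OF f(1)])
      have "inj_on (\<lambda>k. pt p (real k)) {..3 * e}" by (auto simp: inj_on_def pt_def tqw)
      then show "card ((\<lambda>k. pt p (real k)) ` {..3 * e}) > 3 * e" by (simp add: card_image)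
      show "f x = 0 \<and> (\<exists>s. x = (w - q * t + s * (- t\<^sup>2), q + s * t, 0 + s * 1))"
        if x: "x \<in> (\<lambda>k. pt p (real k)) ` {..3 * e}" for x
      proof -
        have "x \<in> A" using x p(1) by (auto simp: A_def)
        moreover obtain k where "x = pt p (real k)" using x by blast
        then have "x = (w - q * t + real k * (- t\<^sup>2), q + real k * t, 0 + real k * 1)"
          by (simp add: pt_def tqw)
        ultimately show ?thesis using f(3) by blast
      qed
    qed
  qed
  moreover have "real (3 * e) \<le> 9 * sqrt (real (card M))"
    unfolding m_def [symmetric] using e2 sq by linarith
  ultimately show ?thesis using f(1,2) by blast
qed

lemma light_incidence_bound:
  assumes "finite M" "finite N"
  shows "real (card {(p, l). p \<in> M \<and> l \<in> N \<and> on_line p l})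
           \<le> 9 * sqrt (real (card M)) * real (card M) + 2 * real (card N)"
proof (cases "M = {}")
  case False
  obtain d f r where f: "polyfun d f" "f r \<noteq> 0" "\<And>p l. p \<in> M \<Longrightarrow> on_line p l \<Longrightarrow> f l = 0"
    "real d \<le> 9 * sqrt (real (card M))"
    using light_polynomial [OF assms(1) False] by blast
  have "card {(p, l). p \<in> M \<and> l \<in> N \<and> on_line p l} \<le> d * card M + 2 * card N"
    by (rule light_incidences_vanishing [OF assms f(1-3)])
  from of_nat_mono [OF this, where 'a = real]
  have "real (card {(p, l). p \<in> M \<and> l \<in> N \<and> on_line p l}) \<le> real d * real (card M) + 2 * real (card N)"
    by simp
  also have "\<dots> \<le> 9 * sqrt (real (card M)) * real (card M) + 2 * real (card N)"
    using f(4) by (intro add_mono mult_right_mono) auto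
  finally show ?thesis .
qed simp

text \<open>Incidences split into zeros of \<open>f\<close> on lines that leave the zero set
  (\<open>I1\<close>), incidences on lines inside it (\<open>I2\<close>), and incidences in the
  cells (\<open>I3\<close>). The first two cost \<open>d\<close> per line and 1 per point, the cells
  \<open>2 * (d + 1)\<close> per line, so the coefficient of \<open>card L\<close> is
  \<open>3 * d + 2\<close>, at most \<open>56 * 2 ^ K\<close>; it is rounded up to
  \<open>74 * 2 ^ K\<close>.\<close>

lemma partition_incidence_bound:
  assumes P: "finite P" and L: "finite L"
  shows "real (card {(p, l). p \<in> P \<and> l \<in> L \<and> on_line p l})
     \<le> 74 * 2 ^ K * real (card L) + real (card P) + 9 * sqrt (real (card P) / 8 ^ K) * real (card P)"
proof -
  obtain d f and \<sigma> :: "point3 \<Rightarrow> nat \<Rightarrow> real" where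
    part: "polyfun d f \<and> (\<exists>p. f p \<noteq> 0) \<and> d \<le> 18 * 2 ^ K \<and>
    (\<forall>s. 8 ^ K * card {p\<in>P. f p \<noteq> 0 \<and> \<sigma> p = s} \<le> card P) \<and>
    (\<forall>x y z a b c. finite (\<sigma> ` {p. f p \<noteq> 0 \<and> (\<exists>t. p = (x + t * a, y + t * b, z + t * c))}) \<and>
       card (\<sigma> ` {p. f p \<noteq> 0 \<and> (\<exists>t. p = (x + t * a, y + t * b, z + t * c))}) \<le> d + 1)"
    using polynomial_partition [OF P, of K] by (elim exE)
  have f: "polyfun d f" "\<exists>p. f p \<noteq> 0" and d: "d \<le> 18 * 2 ^ K" using part by simp_all
  have cell: "8 ^ K * card {p\<in>P. f p \<noteq> 0 \<and> \<sigma> p = s} \<le> card P" for s using part by blast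
  have line: "finite (\<sigma> ` {p. f p \<noteq> 0 \<and> (\<exists>t. p = (x + t * a, y + t * b, z + t * c))}) \<and>
       card (\<sigma> ` {p. f p \<noteq> 0 \<and> (\<exists>t. p = (x + t * a, y + t * b, z + t * c))}) \<le> d + 1" for x y z a b c
    using part by blast
  define Z where "Z = {l\<in>L. \<forall>p. on_line p l \<longrightarrow> f p = 0}"
  define P0 where "P0 = {p\<in>P. f p \<noteq> 0}"
  define Pc where "Pc s = {p\<in>P0. \<sigma> p = s}" for s
  define Lc where "Lc s = {l\<in>L. \<exists>p\<in>Pc s. on_line p l}" for s
  define I1 where "I1 = (SIGMA l:L - Z. {p\<in>P. on_line p l \<and> f p = 0})"
  define I2 where "I2 = {(l, p). l \<in> Z \<and> p \<in> P \<and> on_line p l}"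
  define I3 where "I3 s = {(p, l). p \<in> Pc s \<and> l \<in> Lc s \<and> on_line p l}" for s
  have fin: "finite Z" "finite P0" "finite (Pc s)" "finite (Lc s)" for s
    using P L by (auto simp: Z_def P0_def Pc_def Lc_def)
  have "card {p\<in>P. on_line p l \<and> f p = 0} \<le> d" if l: "l \<in> L - Z" for l
  proof (rule ccontr)
    assume *: "\<not> ?thesis"
    obtain A B C where ABC: "l = (A, B, C)" by (metis prod_cases3)
    have "f p = 0" if p: "on_line p l" for p
    proof -
      obtain s where s: "p = (0 + s * 1, B + s * (- C), A + s * B)"
        using p on_line_iff_contact ABC by blast
      show ?thesis
        unfolding s
      proof (rule polyfun_vanishes_on_line [OF f(1)])
        show "card {p\<in>P. on_line p l \<and> f p = 0} > d" using * by simp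
        show "f p = 0 \<and> (\<exists>s. p = (0 + s * 1, B + s * (- C), A + s * B))"
          if "p \<in> {p\<in>P. on_line p l \<and> f p = 0}" for p
          using that on_line_iff_contact ABC by blast
      qed
    qed
    then show False using l by (simp add: Z_def)
  qed
  then have "(\<Sum>l\<in>L - Z. card {p\<in>P. on_line p l \<and> f p = 0}) \<le> (\<Sum>l\<in>L - Z. d)" by (rule sum_mono)
  then have "card I1 \<le> card (L - Z) * d" unfolding I1_def using P L by simp
  moreover have "card I2 \<le> d * card Z + 1 * card P"
    unfolding I2_def using f(2) by (elim exE, intro contact_incidences_vanishing [OF fin(1) P f(1)]) (auto simp: Z_def)
  moreover have "card (L - Z) + card Z = card L"
    using L fin(1) by (subst card_Diff_subset) (auto simp: Z_def card_mono)
  then have "card (L - Z) * d + d * card Z = d * card L" by (metis distrib_left mult.commute)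
  ultimately have I12: "card I1 + card I2 \<le> d * card L + card P" by linarith
  have sub: "{(p, l). p \<in> P \<and> l \<in> L \<and> on_line p l} \<subseteq>
      (\<lambda>(l, p). (p, l)) ` I1 \<union> (\<lambda>(l, p). (p, l)) ` I2 \<union> (\<Union>s\<in>\<sigma> ` P0. I3 s)"
  proof clarify
    fix p l assume p: "p \<in> P" and l: "l \<in> L" and i: "on_line p l"
      and n: "(p, l) \<notin> (\<Union>s\<in>\<sigma> ` P0. I3 s)" "(p, l) \<notin> (\<lambda>(l, p). (p, l)) ` I2"
    have "f p = 0"
    proof (rule ccontr)
      assume "f p \<noteq> 0"
      then have "p \<in> Pc (\<sigma> p)" "\<sigma> p \<in> \<sigma> ` P0" using p by (auto simp: P0_def Pc_def)
      then have "(p, l) \<in> I3 (\<sigma> p)" using l i by (auto simp: I3_def Lc_def)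
      then show False using n(1) \<open>\<sigma> p \<in> \<sigma> ` P0\<close> by blast
    qed
    moreover have "l \<notin> Z"
    proof
      assume "l \<in> Z"
      then have "(l, p) \<in> I2" using p i by (simp add: I2_def)
      then show False using n(2) by force
    qed
    ultimately have "(l, p) \<in> I1" using p l i by (simp add: I1_def)
    then show "(p, l) \<in> (\<lambda>(l, p). (p, l)) ` I1" by force
  qed
  have finI: "finite I1" "finite I2" "finite (I3 s)" for s
  proof -
    show "finite I1" unfolding I1_def using P L by auto
    show "finite I2" by (rule finite_subset [of _ "Z \<times> P"]) (use fin P in \<open>auto simp: I2_def\<close>)
    show "finite (I3 s)" by (rule finite_subset [of _ "Pc s \<times> Lc s"]) (use fin in \<open>auto simp: I3_def\<close>)
  qed
  have "card {(p, l). p \<in> P \<and> l \<in> L \<and> on_line p l} \<le>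
      card ((\<lambda>(l, p). (p, l)) ` I1 \<union> (\<lambda>(l, p). (p, l)) ` I2 \<union> (\<Union>s\<in>\<sigma> ` P0. I3 s))"
    using sub finI fin(2) by (intro card_mono) auto
  also have "\<dots> \<le> card ((\<lambda>(l, p). (p, l)) ` I1) + card ((\<lambda>(l, p). (p, l)) ` I2) + card (\<Union>s\<in>\<sigma> ` P0. I3 s)"
    by (meson add_le_mono1 card_Un_le le_trans)
  also have "\<dots> \<le> card I1 + card I2 + (\<Sum>s\<in>\<sigma> ` P0. card (I3 s))"
    using finI fin(2) by (intro add_mono card_image_le card_UN_le) auto
  also have "\<dots> \<le> d * card L + card P + (\<Sum>s\<in>\<sigma> ` P0. card (I3 s))" using I12 by simp
  finally have "card {(p, l). p \<in> P \<and> l \<in> L \<and> on_line p l} \<le> d * card L + card P + (\<Sum>s\<in>\<sigma> ` P0. card (I3 s))" .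
  from of_nat_mono [OF this, where 'a = real]
  have 1: "real (card {(p, l). p \<in> P \<and> l \<in> L \<and> on_line p l}) \<le>
      real d * real (card L) + real (card P) + (\<Sum>s\<in>\<sigma> ` P0. real (card (I3 s)))"
    by simp
  \<comment> \<open>Bounding one factor of the dual bound by the largest cell size makes it linear
    in the size of the cell, so the cells sum to \<open>R * card P\<close>.\<close>
  define R where "R = 9 * sqrt (real (card P) / 8 ^ K)"
  have "real (card (I3 s)) \<le> R * real (card (Pc s)) + 2 * real (card (Lc s))" for s
  proof -
    have "real (card (I3 s)) \<le> 9 * sqrt (real (card (Pc s))) * real (card (Pc s)) + 2 * real (card (Lc s))"
      unfolding I3_def by (rule light_incidence_bound) (use fin in auto)
    also have "9 * sqrt (real (card (Pc s))) \<le> R"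
    proof -
      have "Pc s = {p\<in>P. f p \<noteq> 0 \<and> \<sigma> p = s}" by (auto simp: Pc_def P0_def)
      then have "8 ^ K * card (Pc s) \<le> card P" using cell by simp
      then have "8 ^ K * real (card (Pc s)) \<le> real (card P)"
        by (metis of_nat_le_iff of_nat_mult of_nat_numeral of_nat_power)
      then show ?thesis by (simp add: R_def field_simps)
    qed
    finally show ?thesis by (simp add: mult_right_mono)
  qed
  then have "(\<Sum>s\<in>\<sigma> ` P0. real (card (I3 s))) \<le> (\<Sum>s\<in>\<sigma> ` P0. R * real (card (Pc s)) + 2 * real (card (Lc s)))"
    by (rule sum_mono)
  also have "\<dots> = R * (\<Sum>s\<in>\<sigma> ` P0. real (card (Pc s))) + 2 * (\<Sum>s\<in>\<sigma> ` P0. real (card (Lc s)))"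
    by (simp add: sum.distrib sum_distrib_left)
  also have "\<dots> \<le> R * real (card P) + 2 * (real (card L) * (real d + 1))"
  proof (intro add_mono mult_left_mono)
    have "card P0 = (\<Sum>s\<in>\<sigma> ` P0. card (Pc s))"
      using sum.image_gen [OF fin(2), of "\<lambda>_. 1 :: nat" \<sigma>] by (simp add: Pc_def)
    moreover have "card P0 \<le> card P" unfolding P0_def using P by (intro card_mono) auto
    ultimately show "(\<Sum>s\<in>\<sigma> ` P0. real (card (Pc s))) \<le> real (card P)"
      by (simp flip: of_nat_sum)
    \<comment> \<open>Pairs of a cell and a line meeting it are counted by lines instead of by
      cells, where \<open>d + 1\<close> bounds each term.\<close>
    have "(\<Sum>s\<in>\<sigma> ` P0. card (Lc s)) = (\<Sum>s\<in>\<sigma> ` P0. \<Sum>l\<in>L. if \<exists>p\<in>Pc s. on_line p l then 1 else 0)"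
      using L by (intro sum.cong) (auto simp: Lc_def sum.If_cases Int_def)
    also have "\<dots> = (\<Sum>l\<in>L. \<Sum>s\<in>\<sigma> ` P0. if \<exists>p\<in>Pc s. on_line p l then 1 else 0)" by (rule sum.swap)
    also have "\<dots> = (\<Sum>l\<in>L. card {s\<in>\<sigma> ` P0. \<exists>p\<in>Pc s. on_line p l})"
      using fin(2) by (intro sum.cong) (auto simp: sum.If_cases Int_def)
    also have "\<dots> \<le> (\<Sum>l\<in>L. d + 1)"
    proof (rule sum_mono)
      fix l assume "l \<in> L"
      obtain A B C where ABC: "l = (A, B, C)" by (metis prod_cases3)
      let ?T = "\<sigma> ` {p. f p \<noteq> 0 \<and> (\<exists>t. p = (0 + t * 1, B + t * (- C), A + t * B))}"
      have "{s\<in>\<sigma> ` P0. \<exists>p\<in>Pc s. on_line p l} \<subseteq> ?T"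
      proof clarify
        fix p p' assume "p' \<in> Pc (\<sigma> p)" "on_line p' l"
        then have "f p' \<noteq> 0" "\<sigma> p' = \<sigma> p" "\<exists>t. p' = (0 + t * 1, B + t * (- C), A + t * B)"
          using on_line_iff_contact ABC by (auto simp: Pc_def P0_def)
        then show "\<sigma> p \<in> ?T" by (metis (mono_tags, lifting) image_eqI mem_Collect_eq)
      qed
      then have "card {s\<in>\<sigma> ` P0. \<exists>p\<in>Pc s. on_line p l} \<le> card ?T"
        using line by (intro card_mono) blast+
      also have "\<dots> \<le> d + 1" using line by blast
      finally show "card {s\<in>\<sigma> ` P0. \<exists>p\<in>Pc s. on_line p l} \<le> d + 1" .
    qed
    finally have "(\<Sum>s\<in>\<sigma> ` P0. card (Lc s)) \<le> card L * (d + 1)" by simp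
    then have "real (\<Sum>s\<in>\<sigma> ` P0. card (Lc s)) \<le> real (card L * (d + 1))" by (simp only: of_nat_le_iff)
    then show "(\<Sum>s\<in>\<sigma> ` P0. real (card (Lc s))) \<le> real (card L) * (real d + 1)" by (simp add: algebra_simps)
  qed (auto simp: R_def)
  finally have 2: "(\<Sum>s\<in>\<sigma> ` P0. real (card (I3 s))) \<le> R * real (card P) + 2 * (real (card L) * (real d + 1))" .
  have "real d \<le> real (18 * 2 ^ K)" using d by (simp only: of_nat_le_iff)
  then have "3 * real d + 2 \<le> 54 * 2 ^ K + 2 * 1" by simp
  also have "\<dots> \<le> 54 * 2 ^ K + 2 * 2 ^ K" by (intro add_mono mult_left_mono) auto
  also have "\<dots> \<le> (74 * 2 ^ K :: real)" by simp
  finally have "(3 * real d + 2) * real (card L) \<le> 74 * 2 ^ K * real (card L)" by (rule mult_right_mono) simp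
  then show ?thesis using 1 2 unfolding R_def by (simp add: algebra_simps)
qed

text \<open>The ideal value of \<open>2 ^ K\<close> is \<open>x\<close>, for which
  \<open>x * n = y\<close> and \<open>x ^ 3 * y ^ 2 = m ^ 3\<close>, so both terms equal
  \<open>y\<close>. Rounding down to a power of 2 costs a factor less than 2 in \<open>x\<close>,
  hence less than \<open>sqrt 8 < 3\<close> in the second term. If \<open>x < 1\<close> no partition
  is made, and \<open>n\<close> already dominates \<open>m powr (3/2)\<close>.\<close>

lemma optimal_power:
  fixes m n :: real
  assumes "m \<ge> 1" "n \<ge> 1"
  shows "\<exists>K. 2 ^ K * n \<le> m powr (3/5) * n powr (3/5) + n \<and>
             sqrt (m / 8 ^ K) * m \<le> 3 * (m powr (3/5) * n powr (3/5)) + n"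
proof -
  define y where "y = m powr (3/5) * n powr (3/5)"
  define x where "x = m powr (3/5) * n powr (- (2/5))"
  have pos: "m > 0" "n > 0" "x > 0" "y > 0" using assms by (simp_all add: x_def y_def)
  show ?thesis
  proof (cases "x < 1")
    case True
    have "m powr (3/5) < n powr (2/5)"
      using True pos by (simp add: x_def powr_minus field_simps)
    then have "(m powr (3/5)) powr (5/2) \<le> (n powr (2/5)) powr (5/2)"
      by (intro powr_mono2) auto
    then have "m powr (3/2) \<le> n" using pos by (simp add: powr_powr)
    moreover have "sqrt m * m = m powr (3/2)"
    proof -
      have "m powr (3/2) = m powr (1/2 + 1)" by simp
      also have "\<dots> = m powr (1/2) * m powr 1" by (rule powr_add)
      finally show ?thesis using pos by (simp add: powr_half_sqrt)
    qed
    ultimately have "sqrt (m / 8 ^ 0) * m \<le> 3 * y + n" using pos by simp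
    moreover have "2 ^ 0 * n \<le> y + n" using pos by simp
    ultimately show ?thesis unfolding y_def by blast
  next
    case False
    define K where "K = nat \<lfloor>log 2 x\<rfloor>"
    have "log 2 x \<ge> 0" using False by simp
    then have K: "real K \<le> log 2 x" "log 2 x < real K + 1" unfolding K_def by linarith+
    have "2 powr real K \<le> x" using K(1) pos by (simp add: le_log_iff)
    then have K1: "2 ^ K \<le> x" by (simp add: powr_realpow)
    have "x < 2 powr (real K + 1)" using K(2) pos by (simp add: log_less_iff)
    then have K2: "x < 2 * 2 ^ K" by (simp add: powr_add powr_realpow)
    have "x * n = m powr (3/5) * (n powr (- (2/5)) * n powr 1)" using pos by (simp add: x_def)
    also have "\<dots> = y" unfolding y_def using powr_add [of n "- (2/5)" 1] by simp
    finally have "2 ^ K * n \<le> y + n" using mult_right_mono [OF K1, of n] pos by simp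
    moreover have "sqrt (m / 8 ^ K) * m \<le> 3 * y + n"
    proof -
      have "x ^ 3 * y ^ 2 = m ^ 3"
      proof -
        have "x ^ 3 = m powr (9/5) * n powr (- (6/5))"
          using pos by (simp add: x_def power_mult_distrib powr_power)
        moreover have "y ^ 2 = m powr (6/5) * n powr (6/5)"
          using pos by (simp add: y_def power_mult_distrib powr_power)
        ultimately have "x ^ 3 * y ^ 2 = (m powr (9/5) * m powr (6/5)) * (n powr (- (6/5)) * n powr (6/5))"
          by simp
        also have "\<dots> = m powr 3" using pos by (simp flip: powr_add)
        finally show ?thesis using pos by simp
      qed
      moreover have "x ^ 3 \<le> (2 * 2 ^ K) ^ 3" using K2 pos by (intro power_mono) auto
      then have "x ^ 3 \<le> 8 * (2 ^ K) ^ 3" by (simp add: power_mult_distrib)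
      moreover have "(2 ^ K) ^ 3 = (2 ^ 3 :: real) ^ K" by (simp only: power_mult [symmetric] mult.commute)
      ultimately have "m ^ 3 \<le> 8 * 8 ^ K * y ^ 2"
        using mult_right_mono [of "x ^ 3" "8 * 8 ^ K" "y ^ 2"] by simp
      then have 8: "m ^ 3 / 8 ^ K \<le> 8 * y ^ 2" by (simp add: field_simps)
      have "(sqrt (m / 8 ^ K) * m) ^ 2 = (m / 8 ^ K) * m ^ 2"
        using pos by (simp only: power_mult_distrib real_sqrt_pow2_iff) simp
      also have "\<dots> = m ^ 3 / 8 ^ K" by (simp add: power3_eq_cube power2_eq_square)
      also have "\<dots> \<le> 8 * y ^ 2" by (rule 8)
      also have "\<dots> \<le> (3 * y) ^ 2" by (simp add: power_mult_distrib)
      finally have "(sqrt (m / 8 ^ K) * m) ^ 2 \<le> (3 * y) ^ 2" .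
      then have "sqrt (m / 8 ^ K) * m \<le> 3 * y" by (rule power2_le_imp_le) (use pos in simp)
      then show ?thesis using pos by simp
    qed
    ultimately show ?thesis unfolding y_def by blast
  qed
qed

theorem line_incidence_bound:
  assumes P: "finite P" and L: "finite L"
  shows "real (card {(p, l). p \<in> P \<and> l \<in> L \<and> on_line p l})
     \<le> 101 * (real (card P) powr (3/5) * real (card L) powr (3/5) + real (card P) + real (card L))"
proof (cases "P = {} \<or> L = {}")
  case True
  then have e: "{(p, l). p \<in> P \<and> l \<in> L \<and> on_line p l} = {}" by auto
  show ?thesis unfolding e by simp
next
  case False
  then have "real (card P) \<ge> 1" "real (card L) \<ge> 1"
    using P L by (simp_all add: Suc_le_eq card_gt_0_iff)
  from optimal_power [OF this] obtain K where
    K: "2 ^ K * real (card L) \<le> real (card P) powr (3/5) * real (card L) powr (3/5) + real (card L)"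
       "sqrt (real (card P) / 8 ^ K) * real (card P)
          \<le> 3 * (real (card P) powr (3/5) * real (card L) powr (3/5)) + real (card L)"
    by blast
  \<comment> \<open>The constant is \<open>101 = 74 + 9 * 3\<close>, the coefficient of the mixed
    term.\<close>
  show ?thesis using partition_incidence_bound [OF P L, of K] K by simp
qed

section \<open>Lifting directed points and circles to points and lines\<close>

text \<open>The value \<open>tan (\<theta>/2)\<close> for one of the two unit normals \<open>\<plusminus>(cos \<theta>, sin \<theta>)\<close> of the direction;
  the other orientation is accounted for by lifting a circle with both signs of its radius.\<close>

fun tangent_param :: "slope \<Rightarrow> real" where
  "tangent_param Vertical = 0"
| "tangent_param (Slope u) = u + sqrt (u\<^sup>2 + 1)"

text \<open>A finite slope gives a parameter \<open>t > 0\<close>, from which it is recovered as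
  \<open>(t^2 - 1) / (2 t)\<close>; the value 0 is left to the vertical direction.\<close>

lemma inj_tangent_param: "tangent_param u = tangent_param v \<Longrightarrow> u = v"
proof -
  have pos: "u + sqrt (u\<^sup>2 + 1) > 0" for u :: real
  proof -
    have "sqrt (u\<^sup>2 + 1) > sqrt (u\<^sup>2)" by (simp only: real_sqrt_less_iff)
    then show ?thesis by (simp add: abs_if split: if_splits)
  qed
  have inv: "u = ((u + sqrt (u\<^sup>2 + 1))\<^sup>2 - 1) / (2 * (u + sqrt (u\<^sup>2 + 1)))" for u :: real
    using pos [of u] by (simp add: field_simps power2_eq_square)
  assume eq: "tangent_param u = tangent_param v"
  show "u = v"
  proof (cases u)
    case u: (Slope x)
    show ?thesis
    proof (cases v)
      case v: (Slope y)
      have eq': "x + sqrt (x\<^sup>2 + 1) = y + sqrt (y\<^sup>2 + 1)" using eq u v by simp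
      have "x = ((y + sqrt (y\<^sup>2 + 1))\<^sup>2 - 1) / (2 * (y + sqrt (y\<^sup>2 + 1)))"
        by (subst inv) (simp only: eq')
      then show ?thesis unfolding u v by (simp only: inv [of y, symmetric])
    next
      case Vertical
      then show ?thesis using eq u pos [of x] by simp
    qed
  next
    case u: Vertical
    then show ?thesis using eq pos by (cases v) (simp_all, metis less_irrefl)
  qed
qed

fun lift_point :: "directed_point \<Rightarrow> point3" where
  "lift_point (p, u) = (tangent_param u, p $ 2 - tangent_param u * p $ 1, p $ 1 + tangent_param u * p $ 2)"

definition lift_circle :: "real^2 \<Rightarrow> real \<Rightarrow> point3" where
  "lift_circle a s = (a $ 1 - s, a $ 2, a $ 1 + s)"

text \<open>The first coordinate determines the slope. For fixed \<open>t\<close> the other two are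
  linear in the point, with determinant \<open>-(1 + t^2)\<close>.\<close>

lemma inj_lift_point: "inj lift_point"
proof (rule injI)
  fix d d' :: directed_point
  assume eq: "lift_point d = lift_point d'"
  obtain p u where d: "d = (p, u)" by (metis prod.collapse)
  obtain p' u' where d': "d' = (p', u')" by (metis prod.collapse)
  define t where "t = tangent_param u"
  have t: "tangent_param u' = t" and u: "u = u'"
    using eq d d' inj_tangent_param by (auto simp: t_def)
  have 1: "(p $ 2 - p' $ 2) - t * (p $ 1 - p' $ 1) = 0" "(p $ 1 - p' $ 1) + t * (p $ 2 - p' $ 2) = 0"
    using eq t by (auto simp: d d' t_def [symmetric] algebra_simps)
  define X where "X = p $ 1 - p' $ 1"
  define Y where "Y = p $ 2 - p' $ 2"
  have Y: "Y = t * X" and "X + t * Y = 0" using 1 by (auto simp: X_def Y_def)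
  then have "X * (1 + t\<^sup>2) = 0" by (simp add: algebra_simps power2_eq_square)
  moreover have "1 + t\<^sup>2 \<noteq> 0" by (metis add_pos_nonneg less_irrefl zero_le_power2 zero_less_one)
  ultimately have "X = 0" by simp
  then have "p = p'" using Y by (simp add: X_def Y_def vec_eq_iff forall_2)
  then show "d = d'" using u d d' by simp
qed

text \<open>The centre is \<open>p\<close> plus \<open>s\<close> times the unit normal selected by
  \<open>tangent_param\<close>: \<open>(1, 0)\<close> for a vertical tangent and
  \<open>(-w, 1) / \<rho>\<close> for slope \<open>w\<close>. Hence \<open>s\<close> is
  \<open>X\<close> in the first case and \<open>\<rho> * Y\<close> in the second, and tangency
  reduces to \<open>(\<rho> + w) * (\<rho> - w) = 1\<close>.\<close>

lemma incident_imp_on_line: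
  assumes "incident (p, u) c"
  obtains a r s where "c = sphere a r" "0 < r" "\<bar>s\<bar> = r" "on_line (lift_point (p, u)) (lift_circle a s)"
proof -
  obtain a r L where c: "c = sphere a r" "0 < r" "p \<in> c" "L = {x. (x - p) \<bullet> (p - a) = 0}"
    and "has_direction L u"
    using assms unfolding incident_def is_tangent_line_def by auto
  then obtain q v where v: "v \<noteq> 0" "L = {q + t *\<^sub>R v |t. True}" "slope_of v = u"
    unfolding has_direction_def by blast
  have "q + 0 *\<^sub>R v \<in> L" "q + 1 *\<^sub>R v \<in> L" unfolding v(2) by blast+
  then have "(q - p) \<bullet> (p - a) = 0" "(q + v - p) \<bullet> (p - a) = 0" using c(4) by auto
  then have "v \<bullet> (p - a) = 0" by (simp add: inner_simps)
  then have perp: "v $ 1 * (a $ 1 - p $ 1) + v $ 2 * (a $ 2 - p $ 2) = 0"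
    by (simp add: inner_vec_def sum_2 algebra_simps)
  define X where "X = a $ 1 - p $ 1"
  define Y where "Y = a $ 2 - p $ 2"
  have p: "p $ 1 = a $ 1 - X" "p $ 2 = a $ 2 - Y" by (simp_all add: X_def Y_def)
  have "dist a p = r" using c by simp
  then have "sqrt (X\<^sup>2 + Y\<^sup>2) = r"
    by (simp add: dist_vec_def L2_set_def sum_2 dist_real_def X_def Y_def)
  then have XY: "X\<^sup>2 + Y\<^sup>2 = r\<^sup>2" by (metis real_sqrt_pow2 sum_power2_ge_zero)
  show thesis
  proof (cases "v $ 1 = 0")
    case True
    then have u: "u = Vertical" using v(3) by (simp add: slope_of_def)
    have "v $ 2 \<noteq> 0" using v(1) True by (simp add: vec_eq_iff forall_2)
    then have "Y = 0" using perp True by (simp add: Y_def)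
    then have "\<bar>X\<bar> = r" using XY c(2) by (auto simp: power2_eq_iff)
    moreover have "on_line (lift_point (p, u)) (lift_circle a X)"
      using \<open>Y = 0\<close> by (simp add: u lift_circle_def p)
    ultimately show thesis using that c by blast
  next
    case False
    define w where "w = v $ 2 / v $ 1"
    have u: "u = Slope w" using v(3) False by (simp add: slope_of_def w_def)
    have "X + w * Y = 0" using perp False by (simp add: X_def Y_def w_def field_simps)
    then have X: "X = - w * Y" by simp
    define \<rho> where "\<rho> = sqrt (w\<^sup>2 + 1)"
    have \<rho>: "\<rho>\<^sup>2 = w\<^sup>2 + 1" by (simp add: \<rho>_def)
    have "(\<rho> * Y)\<^sup>2 = r\<^sup>2" using XY \<rho> by (simp add: X power_mult_distrib algebra_simps)
    then have "\<bar>\<rho> * Y\<bar> = r" using c(2) unfolding power2_eq_iff by linarith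
    moreover have "on_line (lift_point (p, u)) (lift_circle a (\<rho> * Y))"
    proof -
      have "(w + \<rho>) * (- w * Y + \<rho> * Y) = (\<rho>\<^sup>2 - w\<^sup>2) * Y" by (simp add: algebra_simps power2_eq_square)
      also have "\<dots> = Y" by (simp add: \<rho>)
      finally have 1: "(w + \<rho>) * (- w * Y + \<rho> * Y) = Y" .
      have tp: "tangent_param u = w + \<rho>" by (simp add: u \<rho>_def)
      show ?thesis
        unfolding lift_point.simps lift_circle_def on_line.simps tp p
        using 1 by (simp add: X algebra_simps)
    qed
    ultimately show thesis using that c by blast
  qed
qed

text \<open>If the centres differed, the two points of the first sphere on the line through them
  would have distances |D - r| and D + r from \<open>a'\<close>, where D > 0 is the distance of the
  centres; for \<open>r > 0\<close> these are not equal.\<close>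

lemma sphere_eq_sphereD:
  fixes a a' :: "'a::euclidean_space"
  assumes eq: "sphere a r = sphere a' r'" and r: "0 < r" "0 < r'"
  shows "a = a' \<and> r = r'"
proof -
  have a: "a = a'"
  proof (rule ccontr)
    assume "a \<noteq> a'"
    define d where "d = a' - a"
    have d: "norm d > 0" using \<open>a \<noteq> a'\<close> by (simp add: d_def)
    define e where "e = (1 / norm d) *\<^sub>R d"
    have e: "norm e = 1" "d = norm d *\<^sub>R e" using d by (simp_all add: e_def)
    have a': "a' = a + norm d *\<^sub>R e" using e(2) by (simp add: d_def algebra_simps)
    have mem: "dist a' (a + t *\<^sub>R e) = r'" if "\<bar>t\<bar> = r" for t
    proof -
      have "a + t *\<^sub>R e \<in> sphere a r" using that e(1) by (simp add: dist_norm)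
      then show ?thesis unfolding eq by simp
    qed
    have dd: "dist a' (a + t *\<^sub>R e) = \<bar>norm d - t\<bar>" for t
    proof -
      have "a' - (a + t *\<^sub>R e) = (norm d - t) *\<^sub>R e"
        unfolding scaleR_left_diff_distrib by (subst a') simp
      then show ?thesis using e(1) by (simp add: dist_norm)
    qed
    have "\<bar>norm d - r\<bar> = r'" "\<bar>norm d - (- r)\<bar> = r'"
      using mem [of r] mem [of "- r"] r unfolding dd by auto
    then show False using d r by linarith
  qed
  obtain p where p: "p \<in> sphere a r" using r(1) by (metis less_imp_le ex_in_conv sphere_eq_empty not_less)
  then have "p \<in> sphere a' r'" using eq by simp
  then show ?thesis using p a by simp
qed

theorem theorem3p1:
  "\<exists>K::real. \<forall>(P :: directed_point set) (C :: (real^2) set set) (m::nat) (n::nat).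
     finite P \<and> card P = m \<and> finite C \<and> card C = n \<and> (\<forall>c\<in>C. is_circle c) \<longrightarrow>
       real (incidences P C)
         \<le> K * (real m powr (3/5) * real n powr (3/5) + real m + real n)"
proof (intro exI allI impI)
  fix P :: "directed_point set" and C :: "(real^2) set set" and m n :: nat
  assume "finite P \<and> card P = m \<and> finite C \<and> card C = n \<and> (\<forall>c\<in>C. is_circle c)"
  then have P: "finite P" "card P = m" and C: "finite C" "card C = n" by auto
  \<comment> \<open>A circle is given as a set, so its lift goes through its centre and radius; the
    Boolean \<open>k\<close> selects the sign of the radius.\<close>
  define lift where "lift c k l \<longleftrightarrow> (\<exists>a r. c = sphere a r \<and> 0 < r \<and> l = lift_circle a (if k then r else - r))"
    for c k l
  define l where "l c k = (SOME l. lift c k l)" for c k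
  have uniq: "l c k = lift_circle a (if k then r else - r)" if c: "c = sphere a r" "0 < r" for c k a r
  proof -
    have "lift c k (l c k)"
      unfolding l_def by (rule someI [of _ "lift_circle a (if k then r else - r)"]) (use c in \<open>auto simp: lift_def\<close>)
    then obtain a' r' where "c = sphere a' r'" "0 < r'" "l c k = lift_circle a' (if k then r' else - r')"
      unfolding lift_def by blast
    moreover have "a' = a \<and> r' = r"
      using sphere_eq_sphereD [of a r a' r'] c calculation by auto
    ultimately show ?thesis by simp
  qed
  define L where "L = (\<lambda>(c, k). l c k) ` (C \<times> UNIV)"
  have L: "finite L" unfolding L_def using C by simp
  have "card L \<le> card (C \<times> (UNIV :: bool set))" unfolding L_def using C by (intro card_image_le) simp
  then have cardL: "card L \<le> 2 * n" using C by (simp add: card_cartesian_product)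
  define I where "I = {(d, c). d \<in> P \<and> c \<in> C \<and> incident d c}"
  define J where "J = {(p, l). p \<in> lift_point ` P \<and> l \<in> L \<and> on_line p l}"
  have "\<exists>k. on_line (lift_point d) (l c k)" if "incident d c" for d c
  proof -
    obtain p u where d: "d = (p, u)" by (metis prod.collapse)
    obtain a r s where *: "c = sphere a r" "0 < r" "\<bar>s\<bar> = r" "on_line (lift_point d) (lift_circle a s)"
      using incident_imp_on_line [of p u c] \<open>incident d c\<close> d by metis
    have "s = (if s > 0 then r else - r)" using * by auto
    then show ?thesis using uniq [OF *(1,2), of "s > 0"] *(4) by metis
  qed
  then obtain k where k: "\<And>d c. incident d c \<Longrightarrow> on_line (lift_point d) (l c (k d c))" by metis
  \<comment> \<open>Each incidence is sent to one incidence of lifted objects, using the orientation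
    that works for it. This loses nothing: the lifted circle determines the centre and, both radii
    being positive, also the sign and the radius.\<close>
  define g where "g = (\<lambda>(d, c). (lift_point d, l c (k d c)))"
  have "inj_on g I"
  proof (rule inj_onI)
    fix x x' assume x: "x \<in> I" "x' \<in> I" and eq: "g x = g x'"
    obtain d c where dc: "x = (d, c)" by (metis prod.collapse)
    obtain d' c' where dc': "x' = (d', c')" by (metis prod.collapse)
    have "d = d'" using eq injD [OF inj_lift_point, of d d'] by (simp add: g_def dc dc')
    have "is_circle c" "is_circle c'"
      using x dc dc' by (auto simp: I_def incident_def is_tangent_line_def is_circle_def)
    then obtain a r a' r' where s: "c = sphere a r" "0 < r" "c' = sphere a' r'" "0 < r'"
      unfolding is_circle_def by blast
    have "lift_circle a (if k d c then r else - r) = lift_circle a' (if k d' c' then r' else - r')"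
      using eq uniq [OF s(1,2)] uniq [OF s(3,4)] by (simp add: g_def dc dc')
    then have "a $ 1 = a' $ 1" "a $ 2 = a' $ 2" "r = r'"
      using s(2,4) by (auto simp: lift_circle_def split: if_splits)
    then have "a = a'" "r = r'" by (simp_all add: vec_eq_iff forall_2)
    then show "x = x'" using s \<open>d = d'\<close> by (simp add: dc dc')
  qed
  moreover have "g ` I \<subseteq> J"
    using k by (force simp: I_def J_def L_def g_def)
  moreover have "finite J"
    by (rule finite_subset [of _ "(lift_point ` P) \<times> L"]) (use P L in \<open>auto simp: J_def\<close>)
  ultimately have "card I \<le> card J" by (metis card_inj_on_le)
  then have "real (incidences P C) \<le> real (card J)" by (simp add: incidences_def I_def)
  also have "\<dots> \<le> 101 * (real (card (lift_point ` P)) powr (3/5) * real (card L) powr (3/5)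
      + real (card (lift_point ` P)) + real (card L))"
    unfolding J_def by (rule line_incidence_bound) (use P L in auto)
  also have "card (lift_point ` P) = m"
    using P inj_lift_point by (metis card_image inj_on_subset subset_UNIV)
  \<comment> \<open>The two orientations give at most \<open>2 * n\<close> lines;
    \<open>2 powr (3/5)\<close> is bounded by 2, so the final constant is twice 101.\<close>
  also have "101 * (real m powr (3/5) * real (card L) powr (3/5) + real m + real (card L))
      \<le> 101 * (real m powr (3/5) * (2 * real n powr (3/5)) + 2 * real m + 2 * real n)"
  proof (intro mult_left_mono add_mono)
    have "real (card L) powr (3/5) \<le> (2 * real n) powr (3/5)"
      using cardL by (intro powr_mono2) auto
    also have "\<dots> = 2 powr (3/5) * real n powr (3/5)" by (simp add: powr_mult)
    also have "\<dots> \<le> 2 powr 1 * real n powr (3/5)" by (intro mult_right_mono powr_mono) auto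
    finally show "real (card L) powr (3/5) \<le> 2 * real n powr (3/5)" by simp
  qed (use cardL in auto)
  finally show "real (incidences P C) \<le> 202 * (real m powr (3/5) * real n powr (3/5) + real m + real n)"
    by (simp add: algebra_simps)
qed

end
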